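(* Let $E$ be an arbitrary directed graph and $K$ a field. Assume that $v\in E^0$ is an infinite emitter and that $v\in B_{H(v)}$. Then the annihilator in $L_K(E)$ of the simple left module $\mathbf N_v^{B_{H(v)}}$ is precisely $I(H(v),B_{H(v)}\setminus\{v\})$.
   Context: A directed graph $E=(E^0,E^1,r,s)$ consists of sets $E^0$ (vertices), $E^1$ (edges), of any cardinality, and maps $r,s:E^1\to E^0$. A vertex $v$ is a sink if $s^{-1}(v)=\emptyset$, regular if $s^{-1}(v)$ is finite and non-empty, an infinite emitter if $s^{-1}(v)$ is infinite. Vertices are paths of length $0$; $u\ge v$ means there is a path from $u$ to $v$. $L_K(E)$ (Leavitt path algebra) is the $K$-algebra generated by pairwise orthogonal idempotents $v\in E^0$ and elements $e,e^*$ ($e\in E^1$) with relations: $s(e)e=e=er(e)$; $r(e)e^*=e^*=e^*s(e)$; $e^*e=r(e)$ and $e^*f=0$ for $e\ne f$; $v=\sum_{s(e)=v}ee^*$ for every regular vertex $v$. $H(v)=E^0\setminus\{w\in E^0:w\ge v\}$; for $v$ an infinite emitter it is hereditary saturated (hereditary: $u\in H,u\ge u'$ imply $u'\in H$; saturated: a regular $u$ with $r(s^{-1}(u))\subseteq H$ lies in $H$). For a hereditary saturated $H$, $B_H$ is the set of infinite emitters $u\in E^0\setminus H$ with $1\le|s^{-1}(u)\cap r^{-1}(E^0\setminus H)|<\infty$; for $u\in B_H$, $u^H=u-\sum_{s(e)=u,\,r(e)\notin H}ee^*$; for $S\subseteq B_H$, $I(H,S)$ is the two-sided ideal of $L_K(E)$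 generated by $H\cup\{u^H:u\in S\}$. The quotient graph $E\backslash(H,S)$ has vertices $(E^0\setminus H)\cup\{u':u\in B_H\setminus S\}$ and edges $\{e\in E^1:r(e)\notin H\}\cup\{e':e\in E^1,r(e)\in B_H\setminus S\}$, with $s(e')=s(e)$, $r(e')=r(e)'$. There is a surjection $L_K(E)\to L_K(E\backslash(H,S))$ with kernel $I(H,S)$, given by: vertices $u\in H$ and edges $e$ (and $e^*$) with $r(e)\in H$ go to $0$; $u\mapsto u+u'$ if $u\in B_H\setminus S$ and $u\mapsto u$ for other $u\notin H$; $e\mapsto e+e'$, $e^*\mapsto e^*+(e')^*$ if $r(e)\in B_H\setminus S$, and $e\mapsto e$, $e^*\mapsto e^*$ for other $e$ with $r(e)\notin H$. For a sink $w$ of a graph $F$, $\mathbf N_w$ is the $K$-space with basis all finite paths in $F$ ending in $w$, with left $L_K(F)$-action on a basis path $q$: $u\cdot q=q$ if $u=s(q)$, else $0$; $e\cdot q=eq$ if $r(e)=s(q)$, else $0$; $e^*\cdot q=q'$ if $q=eq'$, else $0$ (so $e^*\cdot w=0$); it is simple. For $v\in B_{H(v)}$ let $F=E\backslash(H(v),B_{H(v)}\setminus\{v\})$. Then $v'$ is a sink in $F$, and $\mathbf N_v^{B_{H(v)}}$ is the $L_K(F)$-module $\mathbf N_{v'}$ viewed as an $L_K(E)$-module via the quotient map $L_K(E)\to L_K(F)$. *)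

theory Defs
  imports
    "HOL-Library.Poly_Mapping"
    "HOL-Algebra.QuotRing"
    "HOL-Algebra.Module"
    "Graph_Theory.Digraph"
    "Graph_Theory.Arc_Walk"
begin

section \<open>Non-unital algebras over a field\<close>

text \<open>
  Leavitt path algebras have no unit when the graph has infinitely many vertices. All algebras
  below are therefore records of type \<open>('k, 'a) module\<close>, with scalars in a type \<open>'k\<close> of class
  \<open>field\<close>, whose field \<open>one\<close> has no meaning and is never used. The locale \<open>ideal\<close> and the
  constant \<open>genideal\<close> of HOL-Algebra presuppose a ring with unit, so ideals of algebras are
  introduced separately.
\<close>

definition algebra_ideal :: "('k, 'a, 'm) module_scheme \<Rightarrow> 'a set \<Rightarrow> bool" where
  "algebra_ideal A I \<longleftrightarrow>
     additive_subgroup I A \<and>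
     (\<forall>a\<in>carrier A. \<forall>x\<in>I. a \<otimes>\<^bsub>A\<^esub> x \<in> I \<and> x \<otimes>\<^bsub>A\<^esub> a \<in> I) \<and>
     (\<forall>c. \<forall>x\<in>I. c \<odot>\<^bsub>A\<^esub> x \<in> I)"

definition ideal_gen :: "('k, 'a, 'm) module_scheme \<Rightarrow> 'a set \<Rightarrow> 'a set" where
  "ideal_gen A X = \<Inter> {I. algebra_ideal A I \<and> X \<subseteq> I}"

definition quotient_algebra :: "('k, 'a) module \<Rightarrow> 'a set \<Rightarrow> ('k, 'a set) module" where
  "quotient_algebra A I =
     \<lparr>carrier = a_rcosets\<^bsub>A\<^esub> I, mult = rcoset_mult A I, one = undefined, zero = I,
      add = set_add A, smult = (\<lambda>c X. \<Union>x\<in>X. I +>\<^bsub>A\<^esub> (c \<odot>\<^bsub>A\<^esub> x))\<rparr>"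

text \<open>
  The map induced on cosets by a function \<open>f\<close> that is constant on each of them
  (the library uses the same device for the homomorphism theorem for rings).
\<close>

definition on_coset :: "('a \<Rightarrow> 'b) \<Rightarrow> 'a set \<Rightarrow> 'b" where
  "on_coset f X = the_elem (f ` X)"

text \<open>
  A left module over an algebra with elements of type \<open>'a\<close> is a record of type
  \<open>('a, 'n) module\<close>, in which \<open>mult\<close> and \<open>one\<close> have no meaning, as in HOL-Algebra.
\<close>

definition annihilator :: "('k, 'a) module \<Rightarrow> ('a, 'n) module \<Rightarrow> 'a set" where
  "annihilator A N = {a \<in> carrier A. \<forall>x\<in>carrier N. a \<odot>\<^bsub>N\<^esub> x = \<zero>\<^bsub>N\<^esub>}"

definition restrict_scalars :: "('a \<Rightarrow> 'b) \<Rightarrow> ('b, 'n) module \<Rightarrow> ('a, 'n) module" where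
  "restrict_scalars \<phi> N =
     \<lparr>carrier = carrier N, mult = mult N, one = one N, zero = zero N, add = add N,
      smult = (\<lambda>a. smult N (\<phi> a))\<rparr>"


section \<open>Free algebras\<close>

text \<open>
  Words under concatenation, written additively, so that the convolution product of
  \<^theory>\<open>HOL-Library.Poly_Mapping\<close> makes \<open>'g free_word \<Rightarrow>\<^sub>0 'k\<close> the free unital algebra on \<open>'g\<close>.
\<close>

datatype 'g free_word = FWord (letters: "'g list")

instantiation free_word :: (type) monoid_add
begin

definition zero_free_word :: "'a free_word" where
  "zero_free_word = FWord []"

definition plus_free_word :: "'a free_word \<Rightarrow> 'a free_word \<Rightarrow> 'a free_word" where
  "plus_free_word u w = FWord (letters u @ letters w)"

instance
  by standard (simp_all add: zero_free_word_def plus_free_word_def)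

end

definition scale :: "'k::field \<Rightarrow> ('b \<Rightarrow>\<^sub>0 'k) \<Rightarrow> ('b \<Rightarrow>\<^sub>0 'k)" where
  "scale c f = Poly_Mapping.map (\<lambda>x. c * x) f"

text \<open>The free non-unital algebra on a set \<open>X\<close>: the empty word is excluded.\<close>

definition free_algebra :: "'g set \<Rightarrow> ('k::field, 'g free_word \<Rightarrow>\<^sub>0 'k) module" where
  "free_algebra X =
     \<lparr>carrier = {a. \<forall>w\<in>Poly_Mapping.keys a. letters w \<noteq> [] \<and> set (letters w) \<subseteq> X},
      mult = (*), one = undefined, zero = 0, add = (+), smult = scale\<rparr>"

definition gen :: "'g \<Rightarrow> ('g free_word \<Rightarrow>\<^sub>0 'k::field)" where
  "gen g = Poly_Mapping.single (FWord [g]) 1"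

definition free_lift ::
    "('g \<Rightarrow> ('h free_word \<Rightarrow>\<^sub>0 'k)) \<Rightarrow> ('g free_word \<Rightarrow>\<^sub>0 'k::field) \<Rightarrow> ('h free_word \<Rightarrow>\<^sub>0 'k)" where
  "free_lift \<phi> a =
     (\<Sum>w\<in>Poly_Mapping.keys a. scale (Poly_Mapping.lookup a w) (prod_list (map \<phi> (letters w))))"


section \<open>Graphs\<close>

text \<open>
  Source and range are \<^const>\<open>tail\<close> and \<^const>\<open>head\<close>; \<open>out_arcs G v\<close> is the set of edges with
  source \<open>v\<close>, and \<open>u \<rightarrow>\<^sup>*\<^bsub>G\<^esub> v\<close> says that there is a path, possibly of length \<open>0\<close>, from \<open>u\<close> to \<open>v\<close>.
\<close>

definition regular_vertex :: "('v, 'e) pre_digraph \<Rightarrow> 'v \<Rightarrow> bool" where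
  "regular_vertex G v \<longleftrightarrow> v \<in> verts G \<and> finite (out_arcs G v) \<and> out_arcs G v \<noteq> {}"

definition infinite_emitter :: "('v, 'e) pre_digraph \<Rightarrow> 'v \<Rightarrow> bool" where
  "infinite_emitter G v \<longleftrightarrow> v \<in> verts G \<and> infinite (out_arcs G v)"

definition not_above :: "('v, 'e) pre_digraph \<Rightarrow> 'v \<Rightarrow> 'v set" where
  "not_above G v = verts G - {w \<in> verts G. w \<rightarrow>\<^sup>*\<^bsub>G\<^esub> v}"

definition out_arcs_avoiding :: "('v, 'e) pre_digraph \<Rightarrow> 'v set \<Rightarrow> 'v \<Rightarrow> 'e set" where
  "out_arcs_avoiding G H u = {e \<in> out_arcs G u. head G e \<notin> H}"

definition breaking_vertices :: "('v, 'e) pre_digraph \<Rightarrow> 'v set \<Rightarrow> 'v set" where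
  "breaking_vertices G H =
     {u \<in> verts G - H. infinite_emitter G u \<and>
        finite (out_arcs_avoiding G H u) \<and> 1 \<le> card (out_arcs_avoiding G H u)}"

text \<open>\<open>Primed x\<close> is the new copy \<open>x'\<close> of a vertex or an edge \<open>x\<close>.\<close>

datatype 'a primed = Orig 'a | Primed 'a

definition quotient_graph ::
    "('v, 'e) pre_digraph \<Rightarrow> 'v set \<Rightarrow> 'v set \<Rightarrow> ('v primed, 'e primed) pre_digraph" where
  "quotient_graph G H S =
     \<lparr>verts = Orig ` (verts G - H) \<union> Primed ` (breaking_vertices G H - S),
      arcs = Orig ` {e \<in> arcs G. head G e \<notin> H}
             \<union> Primed ` {e \<in> arcs G. head G e \<in> breaking_vertices G H - S},
      tail = (\<lambda>x. case x of Orig e \<Rightarrow> Orig (tail G e) | Primed e \<Rightarrow> Orig (tail G e)),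
      head = (\<lambda>x. case x of Orig e \<Rightarrow> Orig (head G e) | Primed e \<Rightarrow> Primed (head G e))\<rparr>"


section \<open>Leavitt path algebras\<close>

datatype ('v, 'e) lpa_gen = Vertex 'v | Edge 'e | Ghost 'e

type_synonym ('v, 'e, 'k) lpa_free = "('v, 'e) lpa_gen free_word \<Rightarrow>\<^sub>0 'k"
type_synonym ('v, 'e, 'k) lpa = "('v, 'e, 'k) lpa_free set"

definition lpa_free_algebra ::
    "('v, 'e) pre_digraph \<Rightarrow> ('k::field, ('v, 'e, 'k) lpa_free) module" where
  "lpa_free_algebra G = free_algebra (Vertex ` verts G \<union> Edge ` arcs G \<union> Ghost ` arcs G)"

text \<open>The elements that become \<open>0\<close>: left-hand side minus right-hand side of each relation.\<close>

definition lpa_relations :: "('v, 'e) pre_digraph \<Rightarrow> ('v, 'e, 'k::field) lpa_free set" where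
  "lpa_relations G =
     {gen (Vertex u) * gen (Vertex u) - gen (Vertex u) | u. u \<in> verts G}
   \<union> {gen (Vertex u) * gen (Vertex w) | u w. u \<in> verts G \<and> w \<in> verts G \<and> u \<noteq> w}
   \<union> {gen (Vertex (tail G e)) * gen (Edge e) - gen (Edge e) | e. e \<in> arcs G}
   \<union> {gen (Edge e) * gen (Vertex (head G e)) - gen (Edge e) | e. e \<in> arcs G}
   \<union> {gen (Vertex (head G e)) * gen (Ghost e) - gen (Ghost e) | e. e \<in> arcs G}
   \<union> {gen (Ghost e) * gen (Vertex (tail G e)) - gen (Ghost e) | e. e \<in> arcs G}
   \<union> {gen (Ghost e) * gen (Edge e) - gen (Vertex (head G e)) | e. e \<in> arcs G}
   \<union> {gen (Ghost e) * gen (Edge f) | e f. e \<in> arcs G \<and> f \<in> arcs G \<and> e \<noteq> f}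
   \<union> {gen (Vertex v) - (\<Sum>e\<in>out_arcs G v. gen (Edge e) * gen (Ghost e)) | v. regular_vertex G v}"

definition lpa_relation_ideal :: "('v, 'e) pre_digraph \<Rightarrow> ('v, 'e, 'k::field) lpa_free set" where
  "lpa_relation_ideal G = ideal_gen (lpa_free_algebra G) (lpa_relations G)"

definition leavitt_path_algebra ::
    "('v, 'e) pre_digraph \<Rightarrow> ('k::field, ('v, 'e, 'k) lpa) module" where
  "leavitt_path_algebra G = quotient_algebra (lpa_free_algebra G) (lpa_relation_ideal G)"

definition lpa_class ::
    "('v, 'e) pre_digraph \<Rightarrow> ('v, 'e, 'k::field) lpa_free \<Rightarrow> ('v, 'e, 'k) lpa" where
  "lpa_class G a = lpa_relation_ideal G +>\<^bsub>lpa_free_algebra G\<^esub> a"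

text \<open>The element \<open>u\<^sup>H\<close> of a breaking vertex \<open>u\<close>.\<close>

definition gap_element ::
    "('v, 'e) pre_digraph \<Rightarrow> 'v set \<Rightarrow> 'v \<Rightarrow> ('v, 'e, 'k::field) lpa" where
  "gap_element G H u =
     lpa_class G (gen (Vertex u) - (\<Sum>e\<in>out_arcs_avoiding G H u. gen (Edge e) * gen (Ghost e)))"

text \<open>\<open>I(H,S)\<close>\<close>

definition graded_ideal ::
    "('v, 'e) pre_digraph \<Rightarrow> 'v set \<Rightarrow> 'v set \<Rightarrow> ('v, 'e, 'k::field) lpa set" where
  "graded_ideal G H S =
     ideal_gen (leavitt_path_algebra G)
       ((\<lambda>u. lpa_class G (gen (Vertex u))) ` H \<union> gap_element G H ` S)"


section \<open>The quotient map\<close>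

fun quotient_gen ::
    "('v, 'e) pre_digraph \<Rightarrow> 'v set \<Rightarrow> 'v set \<Rightarrow> ('v, 'e) lpa_gen \<Rightarrow>
       ('v primed, 'e primed, 'k::field) lpa_free" where
  "quotient_gen G H S (Vertex u) =
     (if u \<in> H then 0
      else if u \<in> breaking_vertices G H - S
      then gen (Vertex (Orig u)) + gen (Vertex (Primed u))
      else gen (Vertex (Orig u)))"
| "quotient_gen G H S (Edge e) =
     (if head G e \<in> H then 0
      else if head G e \<in> breaking_vertices G H - S
      then gen (Edge (Orig e)) + gen (Edge (Primed e))
      else gen (Edge (Orig e)))"
| "quotient_gen G H S (Ghost e) =
     (if head G e \<in> H then 0
      else if head G e \<in> breaking_vertices G H - S
      then gen (Ghost (Orig e)) + gen (Ghost (Primed e))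
      else gen (Ghost (Orig e)))"

definition lpa_quotient_map ::
    "('v, 'e) pre_digraph \<Rightarrow> 'v set \<Rightarrow> 'v set \<Rightarrow>
       ('v, 'e, 'k::field) lpa \<Rightarrow> ('v primed, 'e primed, 'k) lpa" where
  "lpa_quotient_map G H S =
     on_coset (\<lambda>a. lpa_class (quotient_graph G H S) (free_lift (quotient_gen G H S) a))"


section \<open>The module of paths ending in a sink\<close>

text \<open>
  A path is a pair of its source and its list of edges. \<open>path_act G g q\<close> is the product of the
  generator \<open>g\<close> and the basis path \<open>q\<close>, with \<open>None\<close> for the product \<open>0\<close>.
\<close>

type_synonym ('v, 'e) path = "'v \<times> 'e list"

definition paths_to :: "('v, 'e) pre_digraph \<Rightarrow> 'v \<Rightarrow> ('v, 'e) path set" where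
  "paths_to G w = {(u, p). pre_digraph.awalk G u p w}"

fun path_act ::
    "('v, 'e) pre_digraph \<Rightarrow> ('v, 'e) lpa_gen \<Rightarrow> ('v, 'e) path \<Rightarrow> ('v, 'e) path option" where
  "path_act G (Vertex x) (u, p) = (if x = u then Some (u, p) else None)"
| "path_act G (Edge e) (u, p) = (if head G e = u then Some (tail G e, e # p) else None)"
| "path_act G (Ghost e) (u, []) = None"
| "path_act G (Ghost e) (u, f # p) = (if e = f then Some (head G e, p) else None)"

definition gen_act ::
    "('v, 'e) pre_digraph \<Rightarrow> ('v, 'e) lpa_gen \<Rightarrow>
       (('v, 'e) path \<Rightarrow>\<^sub>0 'k::field) \<Rightarrow> (('v, 'e) path \<Rightarrow>\<^sub>0 'k)" where
  "gen_act G g f =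
     (\<Sum>q\<in>Poly_Mapping.keys f.
        case path_act G g q of
          None \<Rightarrow> 0
        | Some q' \<Rightarrow> Poly_Mapping.single q' (Poly_Mapping.lookup f q))"

definition free_act ::
    "('v, 'e) pre_digraph \<Rightarrow> ('v, 'e, 'k::field) lpa_free \<Rightarrow>
       (('v, 'e) path \<Rightarrow>\<^sub>0 'k) \<Rightarrow> (('v, 'e) path \<Rightarrow>\<^sub>0 'k)" where
  "free_act G a f =
     (\<Sum>w\<in>Poly_Mapping.keys a.
        scale (Poly_Mapping.lookup a w) (foldr (gen_act G) (letters w) f))"

definition sink_module ::
    "('v, 'e) pre_digraph \<Rightarrow> 'v \<Rightarrow> (('v, 'e, 'k::field) lpa, ('v, 'e) path \<Rightarrow>\<^sub>0 'k) module" where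
  "sink_module G w =
     \<lparr>carrier = {f. Poly_Mapping.keys f \<subseteq> paths_to G w},
      mult = undefined, one = undefined, zero = 0, add = (+),
      smult = (\<lambda>x f. on_coset (\<lambda>a. free_act G a f) x)\<rparr>"

definition breaking_module ::
    "('v, 'e) pre_digraph \<Rightarrow> 'v \<Rightarrow>
       (('v, 'e, 'k::field) lpa, ('v primed, 'e primed) path \<Rightarrow>\<^sub>0 'k) module" where
  "breaking_module G v =
     (let H = not_above G v; S = breaking_vertices G H - {v}
      in restrict_scalars (lpa_quotient_map G H S) (sink_module (quotient_graph G H S) (Primed v)))"

end

theory Submission
  imports Defs
begin

text \<open>
  Write \<open>H = H(v)\<close>, \<open>S = B\<^sub>H - {v}\<close> and \<open>F\<close> for the quotient graph, in which \<open>v'\<close> is a sink. A path of \<open>F\<close>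
  that ends in \<open>v'\<close> is a path of \<open>E\<close> that ends in \<open>v\<close>, with a prime at its end, and under this bijection
  the images of the generators of \<open>L(E)\<close> act by the usual rules for paths: prefix an edge, or remove the first
  edge. So the module is the space of paths of \<open>E\<close> ending in \<open>v\<close>, where \<open>e\<^sup>* \<cdot> v = 0\<close> for all edges \<open>e\<close>
  (\<open>quotient_hom_annihilates_iff\<close>).

  Consider therefore any graph and any vertex \<open>w\<close> that is not regular, with the free algebra on the vertices,
  edges and ghost edges acting on the paths that end in \<open>w\<close>. The annihilator turns out to be generated by the
  Leavitt relations, the vertices not above \<open>w\<close> and the elements \<open>u\<^sup>H\<close> of the breaking vertices \<open>u \<noteq> w\<close>
  (\<open>path_annihilator_eq_ideal_gen\<close>). These elements annihilate, since a path to \<open>w\<close> never meets \<open>H\<close>.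
  Conversely, modulo the ideal \<open>I\<close> that they generate, an element \<open>x\<close> is a combination of monomials
  \<open>\<alpha> \<beta>\<^sup>*\<close>. Multiplying from the right by an edge shortens the \<open>\<beta>\<close>, and this allows an induction on their
  length. It reduces \<open>x \<in> I\<close> to the vanishing of the part of \<open>x\<close> without ghost edges, which is tested on a single
  path: at a vertex emitting infinitely many edges outside \<open>H\<close>, on a path whose first edge occurs in no \<open>\<beta>\<close>; at
  \<open>w\<close>, on the path of length \<open>0\<close>; at any other vertex above \<open>w\<close> it is absorbed by the relation \<open>u = \<Sum>e e\<^sup>*\<close>.

  The result is applied twice. For \<open>E\<close> and \<open>v\<close> it computes the annihilator. For \<open>F\<close> and \<open>v'\<close>, where every
  vertex lies above \<open>v'\<close>, it says that the module is faithful; this also shows that the quotient map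
  \<open>L(E) \<rightarrow> L(F)\<close> is well defined (\<open>breaking_module_smult\<close>), since the relations of \<open>E\<close> act as zero.
\<close>

section \<open>Linear maps between spaces with a basis\<close>

lemma lookup_scale: "Poly_Mapping.lookup (scale c f) x = c * Poly_Mapping.lookup f x"
  by (simp add: scale_def map.rep_eq when_def)

interpretation scale: module scale
  by unfold_locales (auto intro!: poly_mapping_eqI simp: lookup_scale lookup_add algebra_simps)

lemma scale_single: "scale c (Poly_Mapping.single q d) = Poly_Mapping.single q (c * d)"
  by (simp add: scale_def)

lemma keys_scale_subset: "Poly_Mapping.keys (scale c f) \<subseteq> Poly_Mapping.keys f"
  by (auto simp: in_keys_iff lookup_scale)

lemma poly_mapping_expansion:
  "f = (\<Sum>q\<in>Poly_Mapping.keys f. scale (Poly_Mapping.lookup f q) (Poly_Mapping.single q 1))"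
proof (rule poly_mapping_eqI)
  fix x
  have "Poly_Mapping.lookup (\<Sum>q\<in>Poly_Mapping.keys f.
            scale (Poly_Mapping.lookup f q) (Poly_Mapping.single q 1)) x
      = (\<Sum>q\<in>Poly_Mapping.keys f. if q = x then Poly_Mapping.lookup f q else 0)"
    unfolding lookup_sum by (rule sum.cong) (auto simp: lookup_scale lookup_single when_def)
  also have "\<dots> = Poly_Mapping.lookup f x"
    by (simp add: in_keys_iff)
  finally show "Poly_Mapping.lookup f x = Poly_Mapping.lookup (\<Sum>q\<in>Poly_Mapping.keys f.
            scale (Poly_Mapping.lookup f q) (Poly_Mapping.single q 1)) x" by simp
qed

abbreviation klinear :: "(('b \<Rightarrow>\<^sub>0 'k::field) \<Rightarrow> ('c \<Rightarrow>\<^sub>0 'k)) \<Rightarrow> bool" where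
  "klinear \<equiv> module_hom scale scale"

lemma klinearI:
  assumes "\<And>f g. T (f + g) = T f + T g" and "\<And>c f. T (scale c f) = scale c (T f)"
  shows "klinear T"
  by unfold_locales (use assms in auto)

lemma klinear_eq_on_basis:
  assumes S: "klinear S" and T: "klinear T"
    and eq: "\<And>q. q \<in> Poly_Mapping.keys f
               \<Longrightarrow> S (Poly_Mapping.single q 1) = T (Poly_Mapping.single q 1)"
  shows "S f = T f"
proof -
  have "S (\<Sum>q\<in>Poly_Mapping.keys f. scale (Poly_Mapping.lookup f q) (Poly_Mapping.single q 1))
      = T (\<Sum>q\<in>Poly_Mapping.keys f. scale (Poly_Mapping.lookup f q) (Poly_Mapping.single q 1))"
    by (simp add: module_hom.sum[OF S] module_hom.sum[OF T] module_hom.scale[OF S]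
        module_hom.scale[OF T] eq)
  then show ?thesis
    by (simp add: poly_mapping_expansion[symmetric])
qed

lemma klinear_0: "klinear (\<lambda>f. 0)"
  by (rule klinearI) (auto simp: scale.scale_zero_right)

text \<open>
  The actions on paths, the homomorphism to the quotient graph and the comparison of path spaces are all
  given on a basis, so one notion provides their linearity.
\<close>

definition linear_extension :: "('a \<Rightarrow> ('b \<Rightarrow>\<^sub>0 'k::field)) \<Rightarrow> ('a \<Rightarrow>\<^sub>0 'k) \<Rightarrow> ('b \<Rightarrow>\<^sub>0 'k)" where
  "linear_extension \<phi> f =
     (\<Sum>q\<in>Poly_Mapping.keys f. scale (Poly_Mapping.lookup f q) (\<phi> q))"

lemma linear_extension_superset:
  assumes "finite A" "Poly_Mapping.keys f \<subseteq> A"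
  shows "linear_extension \<phi> f = (\<Sum>q\<in>A. scale (Poly_Mapping.lookup f q) (\<phi> q))"
  unfolding linear_extension_def
  by (rule sum.mono_neutral_left) (use assms in \<open>auto simp: in_keys_iff\<close>)

lemma klinear_linear_extension:
  fixes \<phi> :: "'a \<Rightarrow> ('b \<Rightarrow>\<^sub>0 'k::field)"
  shows "klinear (linear_extension \<phi>)"
proof (rule klinearI)
  fix f g :: "'a \<Rightarrow>\<^sub>0 'k"
  let ?A = "Poly_Mapping.keys f \<union> Poly_Mapping.keys g"
  have "finite ?A" "Poly_Mapping.keys (f + g) \<subseteq> ?A"
    by (simp_all add: Poly_Mapping.keys_add)
  then show "linear_extension \<phi> (f + g) = linear_extension \<phi> f + linear_extension \<phi> g"
    by (simp add: linear_extension_superset[of ?A] lookup_add scale.scale_left_distrib sum.distrib)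
next
  fix c :: 'k and f :: "'a \<Rightarrow>\<^sub>0 'k"
  show "linear_extension \<phi> (scale c f) = scale c (linear_extension \<phi> f)"
    by (simp add: linear_extension_superset[OF _ keys_scale_subset]
        linear_extension_def[of \<phi> f] lookup_scale scale.scale_sum_right)
qed

lemma linear_extension_single:
  "linear_extension \<phi> (Poly_Mapping.single q c) = scale c (\<phi> q)"
  by (simp add: linear_extension_def)

lemma linear_extension_injective:
  fixes f :: "'a \<Rightarrow>\<^sub>0 'k::field"
  assumes g: "inj g" and zero: "linear_extension (\<lambda>q. Poly_Mapping.single (g q) 1) f = 0"
  shows "f = 0"
proof (rule poly_mapping_eqI)
  fix x
  have "0 = Poly_Mapping.lookup (linear_extension (\<lambda>q. Poly_Mapping.single (g q) 1) f) (g x)"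
    using zero by simp
  also have "\<dots> = (\<Sum>y\<in>Poly_Mapping.keys f. if y = x then Poly_Mapping.lookup f y else 0)"
    unfolding linear_extension_def lookup_sum
    by (rule sum.cong) (auto simp: lookup_scale lookup_single when_def inj_eq[OF g])
  also have "\<dots> = Poly_Mapping.lookup f x" by (simp add: in_keys_iff)
  finally show "Poly_Mapping.lookup f x = Poly_Mapping.lookup 0 x" by simp
qed


section \<open>The free algebra\<close>

lemma mult_scale_left: "scale c a * b = scale c (a * b)"
  for a b :: "'g::monoid_add \<Rightarrow>\<^sub>0 'k::field"
  by (simp add: scale_def mult_map_scale_conv_mult mult.assoc)

lemma mult_scale_right: "a * scale c b = scale c (a * b)"
  for a b :: "'g::monoid_add \<Rightarrow>\<^sub>0 'k::field"
proof -
  have comm: "a * Poly_Mapping.single 0 c = scale c a"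
  proof -
    have "(\<Sum>q\<in>Poly_Mapping.keys a. scale (Poly_Mapping.lookup a q) (Poly_Mapping.single q 1))
            * Poly_Mapping.single 0 c
        = scale c (\<Sum>q\<in>Poly_Mapping.keys a.
            scale (Poly_Mapping.lookup a q) (Poly_Mapping.single q 1))"
      by (simp add: sum_distrib_right scale.scale_sum_right scale_single mult_single mult.commute)
    then show ?thesis by (simp add: poly_mapping_expansion[symmetric])
  qed
  have "a * scale c b = (a * Poly_Mapping.single 0 c) * b"
    by (simp add: scale_def mult_map_scale_conv_mult mult.assoc)
  then show ?thesis by (simp add: comm mult_scale_left)
qed

lemma single_word: "Poly_Mapping.single w (1::'k::field) = prod_list (map gen (letters w))"
proof (cases w)
  case (FWord gs)
  have "Poly_Mapping.single (FWord gs) (1::'k) = prod_list (map gen gs)"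
  proof (induction gs)
    case Nil
    show ?case by (simp add: zero_free_word_def[symmetric])
  next
    case (Cons g gs)
    have "FWord (g # gs) = FWord [g] + FWord gs" by (simp add: plus_free_word_def)
    then have "Poly_Mapping.single (FWord (g # gs)) (1::'k) = gen g * Poly_Mapping.single (FWord gs) 1"
      by (simp add: gen_def mult_single)
    then show ?case by (simp add: Cons)
  qed
  then show ?thesis by (simp add: FWord)
qed

lemma letters_plus [simp]: "letters (u + w) = letters u @ letters w"
  by (simp add: plus_free_word_def)

lemma letters_zero [simp]: "letters 0 = []"
  by (simp add: zero_free_word_def)

abbreviation free_carrier :: "'g set \<Rightarrow> ('g free_word \<Rightarrow>\<^sub>0 'k::field) set" where
  "free_carrier X \<equiv> carrier (free_algebra X)"

lemma free_carrier_iff: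
  "a \<in> free_carrier X \<longleftrightarrow>
     (\<forall>w\<in>Poly_Mapping.keys a. letters w \<noteq> [] \<and> set (letters w) \<subseteq> X)"
  by (simp add: free_algebra_def)

lemma free_algebra_simps [simp]:
  "add (free_algebra X) = (+)" "mult (free_algebra X) = (*)"
  "zero (free_algebra X) = 0" "smult (free_algebra X) = scale"
  by (simp_all add: free_algebra_def)

lemma free_carrier_zero: "0 \<in> free_carrier X"
  by (simp add: free_carrier_iff)

lemma free_carrier_add: "\<lbrakk>a \<in> free_carrier X; b \<in> free_carrier X\<rbrakk> \<Longrightarrow> a + b \<in> free_carrier X"
  using Poly_Mapping.keys_add[of a b] unfolding free_carrier_iff by blast

lemma free_carrier_scale: "a \<in> free_carrier X \<Longrightarrow> scale c a \<in> free_carrier X"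
  using keys_scale_subset[of c a] unfolding free_carrier_iff by blast

lemma free_carrier_uminus: "a \<in> free_carrier X \<Longrightarrow> - a \<in> free_carrier X"
  using free_carrier_scale[of a X "- 1"] by simp

lemma free_carrier_diff: "\<lbrakk>a \<in> free_carrier X; b \<in> free_carrier X\<rbrakk> \<Longrightarrow> a - b \<in> free_carrier X"
  using free_carrier_add[of a X "- b"] free_carrier_uminus[of b X] by simp

lemma free_carrier_mult: "\<lbrakk>a \<in> free_carrier X; b \<in> free_carrier X\<rbrakk> \<Longrightarrow> a * b \<in> free_carrier X"
  using Poly_Mapping.keys_mult[of a b] unfolding free_carrier_iff by fastforce

lemma free_carrier_sum: "(\<And>i. i \<in> A \<Longrightarrow> f i \<in> free_carrier X) \<Longrightarrow> sum f A \<in> free_carrier X"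
  by (induction A rule: infinite_finite_induct) (auto simp: free_carrier_zero free_carrier_add)

lemma free_carrier_gen: "g \<in> X \<Longrightarrow> gen g \<in> free_carrier X"
  by (simp add: free_carrier_iff gen_def)

lemma free_carrier_prod_list:
  "\<lbrakk>as \<noteq> []; set as \<subseteq> free_carrier X\<rbrakk> \<Longrightarrow> prod_list as \<in> free_carrier X"
  by (induction as rule: induct_list012) (auto simp: free_carrier_mult)

lemmas free_carrier_closed = free_carrier_zero free_carrier_add free_carrier_scale
  free_carrier_uminus free_carrier_diff free_carrier_mult free_carrier_sum free_carrier_gen

lemma abelian_group_free_algebra: "abelian_group (free_algebra X :: ('k::field, _) module)"
proof (rule abelian_groupI)
  fix a :: "'a free_word \<Rightarrow>\<^sub>0 'k" assume "a \<in> free_carrier X"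
  then show "\<exists>b\<in>free_carrier X. b \<oplus>\<^bsub>free_algebra X\<^esub> a = \<zero>\<^bsub>free_algebra X\<^esub>"
    by (intro bexI[of _ "- a"]) (auto simp: free_carrier_uminus)
qed (auto simp: free_carrier_closed algebra_simps)

text \<open>
  The condition on inverses lets closure under scalar multiples replace closure under negation. It is
  needed twice, for the free algebra and for its quotient.
\<close>

lemma algebra_ideal_iff:
  fixes A :: "('k::field, 'a) module"
  assumes "abelian_group A" and neg: "\<And>x. x \<in> carrier A \<Longrightarrow> \<ominus>\<^bsub>A\<^esub> x = (- 1) \<odot>\<^bsub>A\<^esub> x"
  shows "algebra_ideal A I \<longleftrightarrow> I \<subseteq> carrier A \<and> \<zero>\<^bsub>A\<^esub> \<in> I \<and>
     (\<forall>x\<in>I. \<forall>y\<in>I. x \<oplus>\<^bsub>A\<^esub> y \<in> I) \<and> (\<forall>c. \<forall>x\<in>I. c \<odot>\<^bsub>A\<^esub> x \<in> I) \<and>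
     (\<forall>a\<in>carrier A. \<forall>x\<in>I. a \<otimes>\<^bsub>A\<^esub> x \<in> I \<and> x \<otimes>\<^bsub>A\<^esub> a \<in> I)"
    (is "?L \<longleftrightarrow> ?R")
proof -
  interpret abelian_group A by fact
  show ?thesis
  proof
    assume ?L
    then have "additive_subgroup I A" by (simp add: algebra_ideal_def)
    then interpret additive_subgroup I A .
    show ?R using \<open>?L\<close> a_subset by (auto simp: algebra_ideal_def a_closed)
  next
    assume R: ?R
    have "additive_subgroup I A"
    proof (intro additive_subgroupI subgroup.intro)
      fix x assume "x \<in> I"
      then show "inv\<^bsub>add_monoid A\<^esub> x \<in> I"
        using R neg[of x] by (auto simp: a_inv_def)
    qed (use R in auto)
    then show ?L using R by (simp add: algebra_ideal_def)
  qed
qed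

lemma free_algebra_uminus:
  assumes "a \<in> free_carrier X"
  shows "\<ominus>\<^bsub>free_algebra X\<^esub> a = - a"
proof -
  interpret abelian_group "free_algebra X :: ('b, 'a free_word \<Rightarrow>\<^sub>0 'b) module"
    by (rule abelian_group_free_algebra)
  show ?thesis
    by (rule minus_equality) (use assms in \<open>auto simp: free_carrier_uminus\<close>)
qed

lemma free_ideal_iff:
  "algebra_ideal (free_algebra X) I \<longleftrightarrow> I \<subseteq> free_carrier X \<and> 0 \<in> I \<and>
     (\<forall>x\<in>I. \<forall>y\<in>I. x + y \<in> I) \<and> (\<forall>c. \<forall>x\<in>I. scale c x \<in> I) \<and>
     (\<forall>a\<in>free_carrier X. \<forall>x\<in>I. a * x \<in> I \<and> x * a \<in> I)"
  by (subst algebra_ideal_iff[OF abelian_group_free_algebra])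
    (simp_all add: free_algebra_uminus)

lemma algebra_ideal_ideal_gen:
  assumes "R \<subseteq> free_carrier X"
  shows "algebra_ideal (free_algebra X) (ideal_gen (free_algebra X) R)"
proof -
  have "algebra_ideal (free_algebra X) (free_carrier X)"
    by (auto simp: free_ideal_iff free_carrier_closed)
  with assms have "ideal_gen (free_algebra X) R \<subseteq> free_carrier X"
    by (auto simp: ideal_gen_def)
  then show ?thesis
    unfolding free_ideal_iff ideal_gen_def by auto
qed

lemma ideal_gen_superset: "R \<subseteq> ideal_gen A R"
  by (auto simp: ideal_gen_def)

lemma ideal_gen_least: "\<lbrakk>algebra_ideal A I; R \<subseteq> I\<rbrakk> \<Longrightarrow> ideal_gen A R \<subseteq> I"
  by (auto simp: ideal_gen_def)


section \<open>Quotient algebras\<close>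

locale free_quotient =
  fixes X :: "'g set" and R :: "('g free_word \<Rightarrow>\<^sub>0 'k::field) set"
  assumes ideal: "algebra_ideal (free_algebra X) R"
begin

abbreviation "A \<equiv> free_algebra X :: ('k, 'g free_word \<Rightarrow>\<^sub>0 'k) module"
abbreviation "Q \<equiv> quotient_algebra A R"
abbreviation "cls a \<equiv> R +>\<^bsub>A\<^esub> a"

lemma R: "R \<subseteq> free_carrier X" "0 \<in> R" "x \<in> R \<Longrightarrow> y \<in> R \<Longrightarrow> x + y \<in> R" "x \<in> R \<Longrightarrow> scale c x \<in> R"
  "a \<in> free_carrier X \<Longrightarrow> x \<in> R \<Longrightarrow> a * x \<in> R" "a \<in> free_carrier X \<Longrightarrow> x \<in> R \<Longrightarrow> x * a \<in> R"
  using ideal unfolding free_ideal_iff by auto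

lemma R_uminus: "x \<in> R \<Longrightarrow> - x \<in> R"
  using R(4)[of x "- 1"] by simp

lemma R_diff: "x \<in> R \<Longrightarrow> y \<in> R \<Longrightarrow> x - y \<in> R"
  using R(3)[of x "- y"] R_uminus by simp

lemma mem_cls: "x \<in> cls a \<longleftrightarrow> x - a \<in> R"
  by (auto simp: a_r_coset_def' intro!: bexI[of _ "x - a"])

lemma cls_eq_iff: "cls a = cls b \<longleftrightarrow> a - b \<in> R"
proof
  assume "cls a = cls b"
  then have "a \<in> cls b" using R(2) by (auto simp: mem_cls)
  then show "a - b \<in> R" by (simp add: mem_cls)
next
  assume *: "a - b \<in> R"
  have "x - a \<in> R \<longleftrightarrow> x - b \<in> R" for x
    using R(3)[OF _ *, of "x - a"] R_diff[OF _ *, of "x - b"] by (auto simp: algebra_simps)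
  then show "cls a = cls b" by (auto simp: mem_cls)
qed

lemma cls_self: "a \<in> cls a"
  by (simp add: mem_cls R)

lemma carrier_Q: "carrier Q = cls ` free_carrier X"
  by (auto simp: quotient_algebra_def A_RCOSETS_def')

lemma zero_Q: "\<zero>\<^bsub>Q\<^esub> = cls 0"
  by (auto simp: quotient_algebra_def mem_cls)

lemma add_Q: "cls a \<oplus>\<^bsub>Q\<^esub> cls b = cls (a + b)"
proof -
  have "x \<in> cls (a + b) \<Longrightarrow> \<exists>i\<in>cls a. \<exists>j\<in>cls b. x = i + j" for x
    by (rule bexI[of _ "x - b"], rule bexI[of _ b]) (auto simp: mem_cls R algebra_simps)
  moreover have "i + j \<in> cls (a + b)" if "i \<in> cls a" "j \<in> cls b" for i j
    using R(3)[of "i - a" "j - b"] that by (simp add: mem_cls algebra_simps)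
  ultimately show ?thesis
    by (auto simp: quotient_algebra_def set_add_def')
qed

lemma mult_Q:
  assumes "a \<in> free_carrier X" "b \<in> free_carrier X"
  shows "cls a \<otimes>\<^bsub>Q\<^esub> cls b = cls (a * b)"
proof -
  have "cls (i * j) = cls (a * b)" if "i \<in> cls a" "j \<in> cls b" for i j
  proof -
    have "i - a \<in> R" "j - b \<in> R" using that by (simp_all add: mem_cls)
    moreover have "j \<in> free_carrier X"
      using free_carrier_add[OF subsetD[OF R(1) \<open>j - b \<in> R\<close>] assms(2)] by simp
    ultimately have "(i - a) * j + a * (j - b) \<in> R" using R assms by auto
    then show ?thesis by (simp add: cls_eq_iff algebra_simps)
  qed
  then have "(\<Union>i\<in>cls a. \<Union>j\<in>cls b. cls (i * j)) = (\<Union>i\<in>cls a. \<Union>j\<in>cls b. cls (a * b))"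
    by (intro SUP_cong refl)
  also have "\<dots> = cls (a * b)"
    using cls_self[of a] cls_self[of b] by (simp only: UN_constant) auto
  finally show ?thesis
    by (simp add: quotient_algebra_def rcoset_mult_def)
qed

lemma smult_Q: "c \<odot>\<^bsub>Q\<^esub> cls a = cls (scale c a)"
proof -
  have "cls (scale c i) = cls (scale c a)" if "i \<in> cls a" for i
    using R(4)[of "i - a" c] that by (simp add: cls_eq_iff mem_cls scale.scale_right_diff_distrib)
  then have "(\<Union>i\<in>cls a. cls (scale c i)) = (\<Union>i\<in>cls a. cls (scale c a))"
    by (rule SUP_cong[OF refl])
  also have "\<dots> = cls (scale c a)"
    using cls_self[of a] by (simp only: UN_constant) auto
  finally show ?thesis
    by (simp add: quotient_algebra_def)
qed

lemmas Q_simps = carrier_Q zero_Q add_Q mult_Q smult_Q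

lemma abelian_group_Q: "abelian_group Q"
proof (rule abelian_groupI)
  fix x assume "x \<in> carrier Q"
  then obtain a where "a \<in> free_carrier X" "x = cls a" by (auto simp: carrier_Q)
  then show "\<exists>y\<in>carrier Q. y \<oplus>\<^bsub>Q\<^esub> x = \<zero>\<^bsub>Q\<^esub>"
    by (intro bexI[of _ "cls (- a)"]) (auto simp: Q_simps free_carrier_uminus)
qed (auto simp: Q_simps free_carrier_closed algebra_simps)

lemma Q_ideal_iff:
  "algebra_ideal Q K \<longleftrightarrow> K \<subseteq> carrier Q \<and> \<zero>\<^bsub>Q\<^esub> \<in> K \<and>
     (\<forall>x\<in>K. \<forall>y\<in>K. x \<oplus>\<^bsub>Q\<^esub> y \<in> K) \<and> (\<forall>c. \<forall>x\<in>K. c \<odot>\<^bsub>Q\<^esub> x \<in> K) \<and>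
     (\<forall>a\<in>carrier Q. \<forall>x\<in>K. a \<otimes>\<^bsub>Q\<^esub> x \<in> K \<and> x \<otimes>\<^bsub>Q\<^esub> a \<in> K)"
proof (rule algebra_ideal_iff[OF abelian_group_Q])
  interpret abelian_group Q by (rule abelian_group_Q)
  fix x assume "x \<in> carrier Q"
  then obtain a where "a \<in> free_carrier X" "x = cls a" by (auto simp: carrier_Q)
  then show "\<ominus>\<^bsub>Q\<^esub> x = (- 1) \<odot>\<^bsub>Q\<^esub> x"
    by (intro minus_equality) (auto simp: Q_simps free_carrier_uminus)
qed

text \<open>
  The correspondence between ideals of a quotient and ideals containing the relations. It moves the
  statement about the graded ideal of the Leavitt path algebra into the free algebra.
\<close>

lemma cls_mem_ideal_gen_iff:
  assumes Y: "Y \<subseteq> free_carrier X" and a: "a \<in> free_carrier X"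
    and R_gen: "R = ideal_gen A S"
  shows "cls a \<in> ideal_gen Q (cls ` Y) \<longleftrightarrow> a \<in> ideal_gen A (S \<union> Y)"
proof -
  let ?L = "ideal_gen A (S \<union> Y)"
  have SR: "S \<subseteq> R" using R_gen ideal_gen_superset[of S A] by simp
  have L: "algebra_ideal A ?L"
    using SR R(1) Y by (intro algebra_ideal_ideal_gen) auto
  have RL: "R \<subseteq> ?L"
    unfolding R_gen by (rule ideal_gen_least) (use L ideal_gen_superset[of "S \<union> Y" A] in \<open>auto simp: R_gen\<close>)
  show ?thesis
  proof
    assume "cls a \<in> ideal_gen Q (cls ` Y)"
    moreover have "algebra_ideal Q (cls ` ?L)"
      using L unfolding Q_ideal_iff free_ideal_iff
      by (auto simp: Q_simps subset_iff)
    moreover have "cls ` Y \<subseteq> cls ` ?L"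
      using ideal_gen_superset[of "S \<union> Y" A] by auto
    ultimately have "cls a \<in> cls ` ?L"
      using ideal_gen_least by blast
    then obtain l where "l \<in> ?L" "a - l \<in> ?L" using RL by (auto simp: cls_eq_iff)
    then have "(a - l) + l \<in> ?L" using L unfolding free_ideal_iff by blast
    then show "a \<in> ?L" by simp
  next
    assume aL: "a \<in> ?L"
    show "cls a \<in> ideal_gen Q (cls ` Y)"
      unfolding ideal_gen_def
    proof safe
      fix K assume K: "algebra_ideal Q K" "cls ` Y \<subseteq> K"
      let ?P = "{x \<in> free_carrier X. cls x \<in> K}"
      have "algebra_ideal A ?P"
        using K(1) unfolding Q_ideal_iff free_ideal_iff carrier_Q zero_Q
        by (auto simp: free_carrier_closed add_Q[symmetric] mult_Q[symmetric] smult_Q[symmetric])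
      moreover have "S \<union> Y \<subseteq> ?P"
      proof -
        have "cls s = \<zero>\<^bsub>Q\<^esub>" if "s \<in> S" for s
          using that SR by (auto simp: zero_Q cls_eq_iff)
        then show ?thesis using K Y SR R(1) by (auto simp: Q_ideal_iff)
      qed
      ultimately have "?L \<subseteq> ?P" by (rule ideal_gen_least)
      then show "cls a \<in> K" using aL by auto
    qed
  qed
qed

lemma on_coset_cls:
  assumes "\<And>x. x \<in> free_carrier X \<Longrightarrow> x - a \<in> R \<Longrightarrow> f x = f a" and "a \<in> free_carrier X"
  shows "on_coset f (cls a) = f a"
proof -
  have "f x = f a" if "x \<in> cls a" for x
  proof (rule assms(1))
    show *: "x - a \<in> R" using that by (simp add: mem_cls)
    then have "x - a \<in> free_carrier X" using R(1) by (rule rev_subsetD)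
    from free_carrier_add[OF this assms(2)] show "x \<in> free_carrier X" by simp
  qed
  then have "f ` cls a = (\<lambda>_. f a) ` cls a"
    by (rule image_cong[OF refl])
  also have "\<dots> = {f a}"
    using cls_self[of a] by (rule image_constant)
  finally show ?thesis by (simp add: on_coset_def)
qed

end


section \<open>The action on paths ending in a vertex\<close>

definition lpa_gens :: "('v, 'e) pre_digraph \<Rightarrow> ('v, 'e) lpa_gen set" where
  "lpa_gens G = Vertex ` verts G \<union> Edge ` arcs G \<union> Ghost ` arcs G"

lemma lpa_free_algebra_eq: "lpa_free_algebra G = free_algebra (lpa_gens G)"
  by (simp add: lpa_free_algebra_def lpa_gens_def)

lemma in_lpa_gens [simp]:
  "Vertex u \<in> lpa_gens G \<longleftrightarrow> u \<in> verts G"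
  "Edge e \<in> lpa_gens G \<longleftrightarrow> e \<in> arcs G"
  "Ghost e \<in> lpa_gens G \<longleftrightarrow> e \<in> arcs G"
  by (auto simp: lpa_gens_def)

abbreviation lpa_carrier :: "('v, 'e) pre_digraph \<Rightarrow> ('v, 'e, 'k::field) lpa_free set" where
  "lpa_carrier G \<equiv> free_carrier (lpa_gens G)"

abbreviation single_path :: "('v, 'e) path option \<Rightarrow> (('v, 'e) path \<Rightarrow>\<^sub>0 'k::field)" where
  "single_path x \<equiv> (case x of None \<Rightarrow> 0 | Some q \<Rightarrow> Poly_Mapping.single q 1)"

lemma gen_act_eq: "gen_act G g = linear_extension (\<lambda>q. single_path (path_act G g q))"
  by (rule ext) (auto simp: gen_act_def linear_extension_def scale_single
      intro!: sum.cong split: option.split)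

lemma gen_act_single: "gen_act G g (Poly_Mapping.single q 1) = single_path (path_act G g q)"
  by (simp add: gen_act_eq linear_extension_single)

lemma klinear_gen_act: "klinear (gen_act G g)"
  unfolding gen_act_eq by (rule klinear_linear_extension)

lemma klinear_foldr_gen_act: "klinear (foldr (gen_act G) gs)"
  by (induction gs)
    (auto intro!: klinearI simp: module_hom.add[OF klinear_gen_act] module_hom.scale[OF klinear_gen_act]
      module_hom.add module_hom.scale)

lemma free_act_eq:
  "free_act G a f = linear_extension (\<lambda>w. foldr (gen_act G) (letters w) f) a"
  by (simp add: free_act_def linear_extension_def)

lemma klinear_free_act_left: "klinear (\<lambda>a. free_act G a f)"
  unfolding free_act_eq by (rule klinear_linear_extension)

lemma klinear_free_act: "klinear (free_act G a)"
  by (rule klinearI)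
    (simp_all add: free_act_def module_hom.add[OF klinear_foldr_gen_act]
      module_hom.scale[OF klinear_foldr_gen_act] scale.scale_right_distrib sum.distrib
      scale.scale_sum_right mult.commute)

lemmas free_act_simps = module_hom.add[OF klinear_free_act_left] module_hom.diff[OF klinear_free_act_left]
  module_hom.scale[OF klinear_free_act_left] module_hom.sum[OF klinear_free_act_left]
  module_hom.zero[OF klinear_free_act_left] module_hom.neg[OF klinear_free_act_left]
  module_hom.add[OF klinear_free_act] module_hom.diff[OF klinear_free_act]
  module_hom.scale[OF klinear_free_act] module_hom.sum[OF klinear_free_act]
  module_hom.zero[OF klinear_free_act]

lemma free_act_word:
  "free_act G (Poly_Mapping.single w 1) f = foldr (gen_act G) (letters w) f"
  by (simp add: free_act_eq linear_extension_single)

lemma free_act_gen: "free_act G (gen g) f = gen_act G g f"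
  by (simp add: gen_def free_act_word)

lemma free_act_mult: "free_act G (a * b) f = free_act G a (free_act G b f)"
proof (rule klinear_eq_on_basis[where f = a])
  show "klinear (\<lambda>a. free_act G (a * b) f)"
    by (rule klinearI) (simp_all add: distrib_right mult_scale_left free_act_simps)
  show "klinear (\<lambda>a. free_act G a (free_act G b f))"
    by (rule klinear_free_act_left)
  fix u
  show "free_act G (Poly_Mapping.single u 1 * b) f
      = free_act G (Poly_Mapping.single u 1) (free_act G b f)"
  proof (rule klinear_eq_on_basis[where f = b])
    show "klinear (\<lambda>b. free_act G (Poly_Mapping.single u 1 * b) f)"
      by (rule klinearI) (simp_all add: distrib_left mult_scale_right free_act_simps)
    show "klinear (\<lambda>b. free_act G (Poly_Mapping.single u 1) (free_act G b f))"
      by (rule klinearI) (simp_all add: free_act_simps)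
    fix w
    show "free_act G (Poly_Mapping.single u 1 * Poly_Mapping.single w 1) f
        = free_act G (Poly_Mapping.single u 1) (free_act G (Poly_Mapping.single w 1) f)"
      by (simp add: mult_single free_act_word)
  qed
qed

abbreviation path_space :: "('v, 'e) pre_digraph \<Rightarrow> 'v \<Rightarrow> (('v, 'e) path \<Rightarrow>\<^sub>0 'k::field) set" where
  "path_space G w \<equiv> {f. Poly_Mapping.keys f \<subseteq> paths_to G w}"

lemma keys_linear_extension:
  assumes "\<And>q. q \<in> Poly_Mapping.keys f \<Longrightarrow> Poly_Mapping.keys (\<phi> q) \<subseteq> S"
  shows "Poly_Mapping.keys (linear_extension \<phi> f) \<subseteq> S"
  unfolding linear_extension_def
  by (intro order.trans[OF keys_sum] UN_least order.trans[OF keys_scale_subset assms])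

text \<open>
  Everything is proved with this annihilator inside the free algebra, before the Leavitt relations are
  divided out. There generators act on paths by explicit formulas, and no choice of representatives has
  to be justified. Note that \<open>w\<close> may emit edges: the action makes \<open>e\<^sup>* \<cdot> w = 0\<close> all the same, because it
  looks only at the listed edges of a path.
\<close>

definition path_annihilator ::
    "('v, 'e) pre_digraph \<Rightarrow> 'v \<Rightarrow> ('v, 'e, 'k::field) lpa_free set" where
  "path_annihilator G w = {a \<in> lpa_carrier G. \<forall>f\<in>path_space G w. free_act G a f = 0}"

lemma path_annihilator_iff:
  "a \<in> path_annihilator G w \<longleftrightarrow>
     a \<in> lpa_carrier G \<and> (\<forall>q\<in>paths_to G w. free_act G a (Poly_Mapping.single q 1) = 0)"
  using klinear_eq_on_basis[OF klinear_free_act klinear_0]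
  by (fastforce simp: path_annihilator_def)

context wf_digraph
begin

lemma paths_to_iff [simp]: "(u, p) \<in> paths_to G w \<longleftrightarrow> awalk u p w"
  by (simp add: paths_to_def)

lemma not_above_iff: "u \<in> verts G \<Longrightarrow> u \<notin> not_above G w \<longleftrightarrow> (\<exists>p. awalk u p w)"
  by (simp add: not_above_def reachable_awalk)

lemma awalk_source_not_above: "awalk u p w \<Longrightarrow> u \<notin> not_above G w"
  using not_above_iff awalk_hd_in_verts by blast

lemma path_act_paths_to:
  assumes "g \<in> lpa_gens G" "q \<in> paths_to G w" "path_act G g q = Some q'"
  shows "q' \<in> paths_to G w"
proof -
  obtain u p where q: "q = (u, p)" by (cases q)
  show ?thesis
    using assms unfolding q
    by (cases g; cases p) (auto simp: lpa_gens_def awalk_Cons_iff awalk_Nil_iff split: if_splits)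
qed

lemma gen_act_path_space:
  fixes f :: "('a, 'b) path \<Rightarrow>\<^sub>0 'c::field"
  assumes "g \<in> lpa_gens G" "f \<in> path_space G w"
  shows "gen_act G g f \<in> path_space G w"
proof -
  have "Poly_Mapping.keys (single_path (path_act G g q) :: ('a, 'b) path \<Rightarrow>\<^sub>0 'c) \<subseteq> paths_to G w"
    if "q \<in> Poly_Mapping.keys f" for q
    using path_act_paths_to[OF assms(1), of q w] assms(2) that by (auto split: option.split)
  then show ?thesis
    unfolding gen_act_eq by (simp add: keys_linear_extension)
qed

lemma foldr_gen_act_path_space:
  "\<lbrakk>set gs \<subseteq> lpa_gens G; f \<in> path_space G w\<rbrakk> \<Longrightarrow> foldr (gen_act G) gs f \<in> path_space G w"
proof (induction gs)
  case (Cons g gs)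
  then have "gen_act G g (foldr (gen_act G) gs f) \<in> path_space G w"
    by (intro gen_act_path_space) simp_all
  then show ?case by simp
qed simp

lemma free_act_path_space:
  assumes "a \<in> lpa_carrier G" "f \<in> path_space G w"
  shows "free_act G a f \<in> path_space G w"
proof -
  have "Poly_Mapping.keys (foldr (gen_act G) (letters x) f) \<subseteq> paths_to G w"
    if "x \<in> Poly_Mapping.keys a" for x
    using foldr_gen_act_path_space[of "letters x" f w] that assms by (auto simp: free_carrier_iff)
  then show ?thesis
    unfolding free_act_eq by (simp add: keys_linear_extension)
qed

lemma algebra_ideal_path_annihilator:
  "algebra_ideal (free_algebra (lpa_gens G)) (path_annihilator G w)"
  unfolding free_ideal_iff
proof (intro conjI ballI allI)
  fix a x :: "('a, 'b, 'c) lpa_free"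
  assume a: "a \<in> lpa_carrier G" and x: "x \<in> path_annihilator G w"
  show "a * x \<in> path_annihilator G w"
    using a x by (auto simp: path_annihilator_def free_act_mult free_act_simps free_carrier_mult)
  show "x * a \<in> path_annihilator G w"
    using a x free_act_path_space[OF a]
    by (auto simp: path_annihilator_def free_act_mult free_carrier_mult)
qed (auto simp: path_annihilator_def free_act_simps free_carrier_closed)

lemma free_act_vertex:
  "free_act G (gen (Vertex u)) (Poly_Mapping.single (s, p) 1)
     = (if s = u then Poly_Mapping.single (s, p) 1 else 0)"
  by (simp add: free_act_gen gen_act_single)

lemma free_act_edge:
  "free_act G (gen (Edge e)) (Poly_Mapping.single (s, p) 1)
     = (if s = head G e then Poly_Mapping.single (tail G e, e # p) 1 else 0)"
  by (simp add: free_act_gen gen_act_single)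

lemma free_act_ghost:
  "free_act G (gen (Ghost e)) (Poly_Mapping.single (s, p) 1)
     = (case p of [] \<Rightarrow> 0 | f # p' \<Rightarrow> if e = f then Poly_Mapping.single (head G e, p') 1 else 0)"
  by (simp add: free_act_gen gen_act_single split: list.split)

lemmas free_act_path = free_act_vertex free_act_edge free_act_ghost

text \<open>
  On a path, \<open>e e\<^sup>*\<close> removes the first edge and puts it back if that edge is \<open>e\<close>, and gives \<open>0\<close> otherwise.
\<close>

lemma free_act_edge_projection:
  assumes "awalk s p w" "finite A" "A \<subseteq> arcs G"
  shows "free_act G (\<Sum>e\<in>A. gen (Edge e) * gen (Ghost e)) (Poly_Mapping.single (s, p) 1)
       = (if p \<noteq> [] \<and> hd p \<in> A then Poly_Mapping.single (s, p) (1::'k::field) else 0)"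
proof (cases p)
  case Nil
  then show ?thesis by (simp add: free_act_simps free_act_mult free_act_path)
next
  case (Cons f p')
  then have "tail G f = s" using assms(1) by (simp add: awalk_Cons_iff)
  then have "free_act G (gen (Edge e) * gen (Ghost e)) (Poly_Mapping.single (s, p) (1::'k))
      = (if e = f then Poly_Mapping.single (s, p) 1 else 0)" for e
    by (auto simp: Cons free_act_mult free_act_path free_act_simps)
  then show ?thesis
    using assms(2) by (simp add: Cons free_act_simps)
qed

lemma edge_projection_in_carrier:
  "A \<subseteq> arcs G \<Longrightarrow> (\<Sum>e\<in>A. gen (Edge e) * gen (Ghost e)) \<in> lpa_carrier G"
  by (auto intro!: free_carrier_closed)

text \<open>
  This covers the relation of a regular vertex, with \<open>A\<close> all edges that it emits, as well as the elements
  \<open>u\<^sup>H\<close>, with \<open>A\<close> the edges that avoid \<open>H\<close>.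
\<close>

lemma vertex_minus_projection_annihilates:
  assumes "u \<in> verts G" "finite A" "A \<subseteq> out_arcs G u"
    and first: "\<And>p. awalk u p w \<Longrightarrow> p \<noteq> [] \<and> hd p \<in> A"
  shows "gen (Vertex u) - (\<Sum>e\<in>A. gen (Edge e) * gen (Ghost e)) \<in> path_annihilator G w"
  unfolding path_annihilator_iff
proof (intro conjI ballI)
  have A: "A \<subseteq> arcs G" using assms(3) by auto
  show "gen (Vertex u) - (\<Sum>e\<in>A. gen (Edge e) * gen (Ghost e)) \<in> lpa_carrier G"
    using assms(1) A by (intro free_carrier_diff edge_projection_in_carrier free_carrier_gen) auto
  fix q assume "q \<in> paths_to G w"
  then obtain s p where q: "q = (s, p)" "awalk s p w" by (cases q) auto
  have "p \<noteq> [] \<and> hd p \<in> A \<longleftrightarrow> s = u"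
    using first[of p] q(2) assms(3) by (cases p) (auto simp: awalk_Cons_iff)
  then show "free_act G (gen (Vertex u) - (\<Sum>e\<in>A. gen (Edge e) * gen (Ghost e)))
      (Poly_Mapping.single q 1) = 0"
    by (simp add: q(1) module_hom.diff[OF klinear_free_act_left] free_act_vertex
        free_act_edge_projection[OF q(2) assms(2) A])
qed

lemma lpa_relations_in_carrier: "lpa_relations G \<subseteq> lpa_carrier G"
  unfolding lpa_relations_def regular_vertex_def
  by (auto intro!: free_carrier_closed)

text \<open>
  The vertex \<open>w\<close> must not be regular, because the path of length \<open>0\<close> at \<open>w\<close> is killed by every \<open>e e\<^sup>*\<close> but
  not by \<open>w\<close>.
\<close>

lemma lpa_relations_annihilate:
  assumes "\<not> regular_vertex G w"
  shows "lpa_relations G \<subseteq> path_annihilator G w"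
proof -
  have CK: "gen (Vertex u) - (\<Sum>e\<in>out_arcs G u. gen (Edge e) * gen (Ghost e))
      \<in> path_annihilator G w" if "regular_vertex G u" for u
  proof (rule vertex_minus_projection_annihilates)
    fix p assume "awalk u p w"
    moreover have "u \<noteq> w" using that assms by auto
    ultimately show "p \<noteq> [] \<and> hd p \<in> out_arcs G u"
      by (cases p) (auto simp: awalk_Nil_iff awalk_Cons_iff)
  qed (use that in \<open>auto simp: regular_vertex_def\<close>)
  have "x \<in> path_annihilator G w" if "x \<in> lpa_relations G" for x :: "('a, 'b, 'c::field) lpa_free"
  proof (cases "\<exists>u. regular_vertex G u \<and>
      x = gen (Vertex u) - (\<Sum>e\<in>out_arcs G u. gen (Edge e) * gen (Ghost e))")
    case True
    then show ?thesis using CK by auto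
  next
    case False
    have "free_act G x (Poly_Mapping.single (s, p) 1) = 0" if "awalk s p w" for s p
      using \<open>x \<in> lpa_relations G\<close> False that
      by (cases p) (auto simp: lpa_relations_def free_act_simps free_act_mult free_act_path
          awalk_Cons_iff)
    then show ?thesis
      using that lpa_relations_in_carrier by (auto simp: path_annihilator_iff)
  qed
  then show ?thesis by auto
qed

end

definition free_gap :: "('v, 'e) pre_digraph \<Rightarrow> 'v set \<Rightarrow> 'v \<Rightarrow> ('v, 'e, 'k::field) lpa_free" where
  "free_gap G H u =
     gen (Vertex u) - (\<Sum>e\<in>out_arcs_avoiding G H u. gen (Edge e) * gen (Ghost e))"

definition gap_generators ::
    "('v, 'e) pre_digraph \<Rightarrow> 'v set \<Rightarrow> 'v set \<Rightarrow> ('v, 'e, 'k::field) lpa_free set" where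
  "gap_generators G H S = (\<lambda>u. gen (Vertex u)) ` H \<union> free_gap G H ` S"

context wf_digraph
begin

lemma gap_generators_in_carrier:
  assumes "H \<subseteq> verts G" "S \<subseteq> verts G"
  shows "gap_generators G H S \<subseteq> lpa_carrier G"
  using assms
  by (auto simp: gap_generators_def free_gap_def out_arcs_avoiding_def
      intro!: free_carrier_diff edge_projection_in_carrier free_carrier_gen)

text \<open>
  A path to \<open>w\<close> stays among the vertices above \<open>w\<close>. So no such path starts in \<open>H\<close>, and if it starts at
  \<open>u \<noteq> w\<close>, then its first edge avoids \<open>H\<close>.
\<close>

lemma gap_generators_annihilate:
  "gap_generators G (not_above G w) (breaking_vertices G (not_above G w) - {w})
     \<subseteq> path_annihilator G w"
proof -
  let ?H = "not_above G w"
  have "gen (Vertex u) \<in> path_annihilator G w" if "u \<in> ?H" for u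
    using that by (auto simp: path_annihilator_iff free_act_vertex free_carrier_gen not_above_def
        reachable_awalk)
  moreover have "free_gap G ?H u \<in> path_annihilator G w"
    if u: "u \<in> breaking_vertices G ?H - {w}" for u
    unfolding free_gap_def
  proof (rule vertex_minus_projection_annihilates)
    fix p assume p: "awalk u p w"
    then obtain e p' where "p = e # p'" using u by (cases p) (auto simp: awalk_Nil_iff)
    then show "p \<noteq> [] \<and> hd p \<in> out_arcs_avoiding G ?H u"
      using p awalk_source_not_above by (auto simp: out_arcs_avoiding_def awalk_Cons_iff)
  qed (use u in \<open>auto simp: breaking_vertices_def out_arcs_avoiding_def\<close>)
  ultimately show ?thesis by (auto simp: gap_generators_def)
qed

end


section \<open>Calculations modulo an ideal containing the Leavitt relations\<close>

locale leavitt_ideal = wf_digraph G for G :: "('v, 'e) pre_digraph" +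
  fixes I :: "('v, 'e, 'k::field) lpa_free set"
  assumes ideal: "algebra_ideal (free_algebra (lpa_gens G)) I"
    and relations: "lpa_relations G \<subseteq> I"
begin

lemma I_carrier: "x \<in> I \<Longrightarrow> x \<in> lpa_carrier G"
  and I_zero: "0 \<in> I"
  and I_add: "x \<in> I \<Longrightarrow> y \<in> I \<Longrightarrow> x + y \<in> I"
  and I_scale: "x \<in> I \<Longrightarrow> scale c x \<in> I"
  and I_mult_left: "a \<in> lpa_carrier G \<Longrightarrow> x \<in> I \<Longrightarrow> a * x \<in> I"
  and I_mult_right: "a \<in> lpa_carrier G \<Longrightarrow> x \<in> I \<Longrightarrow> x * a \<in> I"
  using ideal unfolding free_ideal_iff by auto

lemma I_uminus: "x \<in> I \<Longrightarrow> - x \<in> I"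
  using I_scale[of x "- 1"] by simp

lemma I_sum: "(\<And>i. i \<in> A \<Longrightarrow> f i \<in> I) \<Longrightarrow> sum f A \<in> I"
  by (induction A rule: infinite_finite_induct) (auto simp: I_zero I_add)

definition eqv :: "('v, 'e, 'k) lpa_free \<Rightarrow> ('v, 'e, 'k) lpa_free \<Rightarrow> bool" (infix \<open>\<approx>\<close> 50) where
  "a \<approx> b \<longleftrightarrow> a - b \<in> I"

lemma eqv_zero: "a \<approx> 0 \<longleftrightarrow> a \<in> I"
  by (simp add: eqv_def)

lemma eqv_refl [simp]: "a \<approx> a"
  by (simp add: eqv_def I_zero)

lemma eqv_sym: "a \<approx> b \<Longrightarrow> b \<approx> a"
  using I_uminus[of "a - b"] by (simp add: eqv_def)

lemma eqv_trans [trans]: "a \<approx> b \<Longrightarrow> b \<approx> c \<Longrightarrow> a \<approx> c"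
  using I_add[of "a - b" "b - c"] by (simp add: eqv_def)

lemma eqv_mem: "a \<approx> b \<Longrightarrow> b \<in> I \<Longrightarrow> a \<in> I"
  using eqv_trans[of a b 0] by (simp add: eqv_zero)

lemma eqv_add: "a \<approx> b \<Longrightarrow> c \<approx> d \<Longrightarrow> a + c \<approx> b + d"
  using I_add[of "a - b" "c - d"] by (simp add: eqv_def algebra_simps)

lemma eqv_scale: "a \<approx> b \<Longrightarrow> scale c a \<approx> scale c b"
  using I_scale[of "a - b" c] by (simp add: eqv_def scale.scale_right_diff_distrib)

lemma eqv_sum: "(\<And>i. i \<in> A \<Longrightarrow> f i \<approx> g i) \<Longrightarrow> sum f A \<approx> sum g A"
  using I_sum[of A "\<lambda>i. f i - g i"] by (simp add: eqv_def sum_subtractf)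

lemma eqv_mult_left: "a \<approx> b \<Longrightarrow> c \<in> lpa_carrier G \<Longrightarrow> c * a \<approx> c * b"
  using I_mult_left[of c "a - b"] by (simp add: eqv_def right_diff_distrib)

lemma eqv_mult_right: "a \<approx> b \<Longrightarrow> c \<in> lpa_carrier G \<Longrightarrow> a * c \<approx> b * c"
  using I_mult_right[of c "a - b"] by (simp add: eqv_def left_diff_distrib)

lemma eqv_mult_gens_left:
  "a \<approx> b \<Longrightarrow> set gs \<subseteq> lpa_gens G \<Longrightarrow> prod_list (map gen gs) * a \<approx> prod_list (map gen gs) * b"
  by (induction gs) (auto simp: mult.assoc intro: eqv_mult_left free_carrier_gen)

definition edges :: "'e list \<Rightarrow> ('v, 'e, 'k) lpa_free" where
  "edges p = prod_list (map (\<lambda>e. gen (Edge e)) p)"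

lemma edges_simps [simp]:
  "edges [] = 1" "edges (e # p) = gen (Edge e) * edges p" "edges (p @ q) = edges p * edges q"
  by (simp_all add: edges_def)

lemma edges_in_carrier:
  "a \<in> lpa_carrier G \<Longrightarrow> set p \<subseteq> arcs G \<Longrightarrow> a * edges p \<in> lpa_carrier G"
  by (induction p arbitrary: a)
    (auto simp: mult.assoc[symmetric] free_carrier_mult free_carrier_gen)

lemma eqv_mult_edges: "a \<approx> b \<Longrightarrow> set p \<subseteq> arcs G \<Longrightarrow> a * edges p \<approx> b * edges p"
  by (induction p arbitrary: a b)
    (auto simp: mult.assoc[symmetric] eqv_mult_right free_carrier_gen)

lemma vertex_vertex:
  "u \<in> verts G \<Longrightarrow> w \<in> verts G
     \<Longrightarrow> gen (Vertex u) * gen (Vertex w) \<approx> (if u = w then gen (Vertex u) else 0)"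
  unfolding eqv_def by (rule subsetD[OF relations], cases "u = w") (auto simp: lpa_relations_def)

lemma
  assumes "e \<in> arcs G"
  shows tail_edge: "gen (Vertex (tail G e)) * gen (Edge e) \<approx> gen (Edge e)"
    and edge_head: "gen (Edge e) * gen (Vertex (head G e)) \<approx> gen (Edge e)"
    and head_ghost: "gen (Vertex (head G e)) * gen (Ghost e) \<approx> gen (Ghost e)"
    and ghost_tail: "gen (Ghost e) * gen (Vertex (tail G e)) \<approx> gen (Ghost e)"
  unfolding eqv_def
  by (rule subsetD[OF relations]; use assms in \<open>auto simp: lpa_relations_def\<close>)+

lemma ghost_edge:
  "e \<in> arcs G \<Longrightarrow> f \<in> arcs G
     \<Longrightarrow> gen (Ghost e) * gen (Edge f) \<approx> (if e = f then gen (Vertex (head G e)) else 0)"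
  unfolding eqv_def by (rule subsetD[OF relations], cases "e = f") (auto simp: lpa_relations_def)

text \<open>
  The vertex by which a generator can be multiplied on the right without changing it.
\<close>

fun right_vertex :: "('v, 'e) lpa_gen \<Rightarrow> 'v" where
  "right_vertex (Vertex u) = u"
| "right_vertex (Edge e) = head G e"
| "right_vertex (Ghost e) = tail G e"

lemma gen_vertex:
  assumes g: "g \<in> lpa_gens G" and u: "u \<in> verts G"
  shows "gen g * gen (Vertex u) \<approx> (if u = right_vertex g then gen g else 0)"
proof -
  let ?r = "right_vertex g"
  have r: "?r \<in> verts G" using g by (cases g) auto
  have "gen g * gen (Vertex ?r) \<approx> gen g"
    using g edge_head ghost_tail vertex_vertex[of ?r ?r] by (cases g) auto
  then have *: "gen g \<approx> gen g * gen (Vertex ?r)" by (rule eqv_sym)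
  have "gen g * gen (Vertex u) \<approx> gen g * (gen (Vertex ?r) * gen (Vertex u))"
    using eqv_mult_right[OF * free_carrier_gen, of "Vertex u"] u by (simp add: mult.assoc)
  also have "\<dots> \<approx> gen g * (if ?r = u then gen (Vertex ?r) else 0)"
    by (intro eqv_mult_left vertex_vertex r u free_carrier_gen g)
  also have "\<dots> \<approx> (if u = ?r then gen g else 0)"
    using eqv_sym[OF *] by auto
  finally show ?thesis .
qed

text \<open>
  The algebra has no unit, but a finite sum of vertices acts as one on any given element: take the right
  vertices of the last letters of its words. This splits an element into pieces \<open>x u\<close> with a single right
  vertex.
\<close>

lemma right_units:
  assumes x: "x \<in> lpa_carrier G"
  shows "\<exists>U. finite U \<and> U \<subseteq> verts G \<and> x \<approx> (\<Sum>u\<in>U. x * gen (Vertex u))"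
proof -
  let ?W = "Poly_Mapping.keys x"
  define r where "r w = right_vertex (last (letters w))" for w
  define U where "U = r ` ?W"
  have word: "Poly_Mapping.single w 1 * gen (Vertex u)
      \<approx> (if u = r w then Poly_Mapping.single w 1 else 0)"
    if w: "w \<in> ?W" and u: "u \<in> verts G" for w u
  proof -
    obtain gs g where gs: "letters w = gs @ [g]" "set gs \<subseteq> lpa_gens G" "g \<in> lpa_gens G"
      using x w by (cases "letters w" rule: rev_cases) (auto simp: free_carrier_iff)
    have "prod_list (map gen gs) * (gen g * gen (Vertex u))
        \<approx> prod_list (map gen gs) * (if u = right_vertex g then gen g else 0)"
      by (intro eqv_mult_gens_left gen_vertex gs u)
    then show ?thesis by (simp add: single_word gs(1) r_def mult.assoc split: if_splits)
  qed
  have "r w \<in> verts G" if "w \<in> ?W" for w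
  proof -
    have "letters w \<noteq> []" "set (letters w) \<subseteq> lpa_gens G"
      using x that by (auto simp: free_carrier_iff)
    then have "last (letters w) \<in> lpa_gens G" using last_in_set by blast
    then show ?thesis by (cases "last (letters w)") (auto simp: r_def)
  qed
  then have U: "finite U" "U \<subseteq> verts G" by (auto simp: U_def)
  have "(\<Sum>u\<in>U. x * gen (Vertex u)) = (\<Sum>u\<in>U. \<Sum>w\<in>?W.
      scale (Poly_Mapping.lookup x w) (Poly_Mapping.single w 1 * gen (Vertex u)))"
    by (subst poly_mapping_expansion[of x]) (simp add: sum_distrib_right mult_scale_left)
  also have "\<dots> = (\<Sum>w\<in>?W. \<Sum>u\<in>U.
      scale (Poly_Mapping.lookup x w) (Poly_Mapping.single w 1 * gen (Vertex u)))"
    by (rule sum.swap)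
  also have "\<dots> \<approx> (\<Sum>w\<in>?W. \<Sum>u\<in>U.
      scale (Poly_Mapping.lookup x w) (if u = r w then Poly_Mapping.single w 1 else 0))"
    using U by (intro eqv_sum eqv_scale word) auto
  also have "\<dots> = (\<Sum>w\<in>?W. scale (Poly_Mapping.lookup x w) (Poly_Mapping.single w 1))"
    using U(1) by (intro sum.cong refl) (simp add: scale.scale_sum_right[symmetric] U_def)
  also have "\<dots> = x" by (simp add: poly_mapping_expansion[symmetric])
  finally show ?thesis using U eqv_sym by blast
qed


subsection \<open>Elements without ghost edges\<close>

fun path_monomial :: "('v, 'e) path \<Rightarrow> ('v, 'e, 'k) lpa_free" where
  "path_monomial (s, p) = gen (Vertex s) * edges p"

lemma path_monomial_in_carrier: "q \<in> paths_to G u \<Longrightarrow> path_monomial q \<in> lpa_carrier G"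
  by (cases q) (auto simp: awalk_def intro!: edges_in_carrier free_carrier_gen)

definition path_combination :: "(('v, 'e) path \<Rightarrow>\<^sub>0 'k) \<Rightarrow> ('v, 'e, 'k) lpa_free" where
  "path_combination = linear_extension path_monomial"

lemma klinear_path_combination: "klinear path_combination"
  unfolding path_combination_def by (rule klinear_linear_extension)

lemma path_combination_in_carrier:
  assumes "c \<in> path_space G u"
  shows "path_combination c \<in> lpa_carrier G"
  unfolding path_combination_def linear_extension_def
  using assms by (auto intro!: free_carrier_sum free_carrier_scale path_monomial_in_carrier)

lemma free_act_edges:
  "cas s p u \<Longrightarrow> free_act G (edges p) (Poly_Mapping.single (u, q) (1::'k))
     = Poly_Mapping.single (s, p @ q) 1"
proof (induction p arbitrary: s)
  case Nil
  have "free_act G 1 f = f" for f :: "('v, 'e) path \<Rightarrow>\<^sub>0 'k"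
    using free_act_word[of G 0 f] by simp
  then show ?case using Nil by simp
qed (simp add: free_act_mult free_act_edge)

text \<open>
  Acting on one path \<open>q\<close> from \<open>u\<close> already determines a combination of paths ending at \<open>u\<close>, since
  prefixing is injective: \<open>p q = p' q\<close> only for \<open>p = p'\<close>.
\<close>

lemma path_combination_acts_injectively:
  assumes c: "c \<in> path_space G u"
    and zero: "free_act G (path_combination c) (Poly_Mapping.single (u, q) 1) = 0"
  shows "c = 0"
proof -
  let ?pre = "\<lambda>(s::'v, p). (s, p @ q)"
  have "free_act G (path_combination c) (Poly_Mapping.single (u, q) 1)
      = linear_extension (\<lambda>x. Poly_Mapping.single (?pre x) 1) c"
  proof (rule klinear_eq_on_basis[OF _ klinear_linear_extension])
    show "klinear (\<lambda>c. free_act G (path_combination c) (Poly_Mapping.single (u, q) 1))"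
      by (rule klinearI) (simp_all add: module_hom.add[OF klinear_path_combination]
          module_hom.scale[OF klinear_path_combination] free_act_simps)
    fix y assume "y \<in> Poly_Mapping.keys c"
    then obtain s p where y: "y = (s, p)" "awalk s p u" using c by (cases y) auto
    then have "cas s p u" by (simp add: awalk_def)
    then show "free_act G (path_combination (Poly_Mapping.single y 1)) (Poly_Mapping.single (u, q) 1)
        = linear_extension (\<lambda>x. Poly_Mapping.single (?pre x) 1) (Poly_Mapping.single y 1)"
      by (simp add: path_combination_def linear_extension_single y(1) free_act_mult
          free_act_edges free_act_vertex)
  qed
  moreover have "inj ?pre" by (auto simp: inj_def)
  ultimately show ?thesis using linear_extension_injective[of ?pre c] zero by simp
qed


subsection \<open>The filtration by ghost degree\<close>

text \<open>
  Modulo \<open>I\<close>, every element is a combination of monomials \<open>\<alpha> \<beta>\<^sup>*\<close> with paths \<open>\<alpha>\<close> and \<open>\<beta>\<close> that have the same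
  range. The predicate says that \<open>x\<close> needs only those with \<open>\<beta>\<close> of length at most \<open>n\<close> and starting at \<open>u\<close>.
  The rule \<open>ghost\<close> adds an edge at the start of \<open>\<beta>\<close>, because \<open>(f \<beta>)\<^sup>* = \<beta>\<^sup>* f\<^sup>*\<close>.
\<close>

inductive ghost_filtered :: "nat \<Rightarrow> 'v \<Rightarrow> ('v, 'e, 'k) lpa_free \<Rightarrow> bool" where
  path: "q \<in> paths_to G u \<Longrightarrow> ghost_filtered n u (path_monomial q)"
| ghost: "f \<in> arcs G \<Longrightarrow> ghost_filtered n (head G f) x
            \<Longrightarrow> ghost_filtered (Suc n) (tail G f) (x * gen (Ghost f))"
| add: "ghost_filtered n u x \<Longrightarrow> ghost_filtered n u y \<Longrightarrow> ghost_filtered n u (x + y)"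
| scale: "ghost_filtered n u x \<Longrightarrow> ghost_filtered n u (scale c x)"
| ideal: "x \<in> I \<Longrightarrow> ghost_filtered n u x"

lemma ghost_filtered_eqv:
  assumes "ghost_filtered n u b" "a \<approx> b"
  shows "ghost_filtered n u a"
  using ghost_filtered.add[OF assms(1) ghost_filtered.ideal[of "a - b"]] assms(2)
  by (simp add: eqv_def)

lemma ghost_filtered_sum:
  "(\<And>i. i \<in> A \<Longrightarrow> ghost_filtered n u (f i)) \<Longrightarrow> ghost_filtered n u (sum f A)"
  by (induction A rule: infinite_finite_induct)
    (auto intro: ghost_filtered.add ghost_filtered.ideal I_zero)

lemma ghost_filtered_mono: "ghost_filtered n u x \<Longrightarrow> n \<le> m \<Longrightarrow> ghost_filtered m u x"
proof (induction arbitrary: m rule: ghost_filtered.induct)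
  case (ghost f n x)
  then obtain k where "m = Suc k" "n \<le> k" by (cases m) auto
  with ghost show ?case by (auto intro: ghost_filtered.ghost)
qed (auto intro: ghost_filtered.intros)

lemma ghost_filtered_in_carrier: "ghost_filtered n u x \<Longrightarrow> x \<in> lpa_carrier G"
  by (induction rule: ghost_filtered.induct)
    (simp_all add: path_monomial_in_carrier I_carrier free_carrier_closed)

lemma ghost_filtered_vertex:
  "ghost_filtered n u x \<Longrightarrow> u \<in> verts G \<Longrightarrow> x * gen (Vertex u) \<approx> x"
proof (induction rule: ghost_filtered.induct)
  case (path q u n)
  obtain s p where q: "q = (s, p)" "awalk s p u" using path by (cases q) auto
  show ?case
  proof (cases p rule: rev_cases)
    case Nil
    then show ?thesis using q vertex_vertex[of u u] path(2) by (simp add: awalk_Nil_iff)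
  next
    case (snoc p' e)
    have "e \<in> arcs G" "head G e = u" "set p' \<subseteq> arcs G" "s \<in> verts G"
      using q(2) snoc by (auto simp: awalk_def)
    then show ?thesis
      using eqv_mult_left[OF edge_head edges_in_carrier, of e "gen (Vertex s)" p']
      by (simp add: q snoc mult.assoc free_carrier_gen)
  qed
next
  case (ghost f n x)
  then show ?case
    using eqv_mult_left[OF ghost_tail ghost_filtered_in_carrier, of f n "head G f" x]
    by (simp add: mult.assoc)
next
  case (add n u x y)
  then show ?case by (simp add: distrib_right eqv_add)
next
  case (scale n u x c)
  then show ?case by (simp add: mult_scale_left eqv_scale)
next
  case (ideal x n u)
  then show ?case
    using eqv_trans[of "x * gen (Vertex u)" 0 x] eqv_sym[of x 0]
    by (simp add: eqv_zero I_mult_right free_carrier_gen)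
qed

text \<open>
  The step that drives the induction: by \<open>f\<^sup>* e = 0\<close> or \<open>e\<^sup>* e = r(e)\<close>, right multiplication by an edge
  kills a monomial \<open>\<alpha> \<beta>\<^sup>*\<close> with ghost edges or removes the first edge of its \<open>\<beta>\<close>. At degree \<open>0\<close> there is
  nothing to remove, and truncated subtraction keeps the degree \<open>0\<close>.
\<close>

lemma ghost_filtered_edge:
  "ghost_filtered n u x \<Longrightarrow> e \<in> out_arcs G u
     \<Longrightarrow> ghost_filtered (n - 1) (head G e) (x * gen (Edge e))"
proof (induction rule: ghost_filtered.induct)
  case (path q u n)
  obtain s p where q: "q = (s, p)" "awalk s p u" using path by (cases q) auto
  then have "awalk s (p @ [e]) (head G e)"
    using path(2) by (auto simp: awalk_def)
  then have "ghost_filtered (n - 1) (head G e) (path_monomial (s, p @ [e]))"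
    by (intro ghost_filtered.path) simp
  then show ?case by (simp add: q mult.assoc)
next
  case (ghost f n x)
  have e: "e \<in> arcs G" and x: "x \<in> lpa_carrier G"
    using ghost ghost_filtered_in_carrier by auto
  have *: "x * gen (Ghost f) * gen (Edge e)
      \<approx> x * (if f = e then gen (Vertex (head G f)) else 0)"
    unfolding mult.assoc by (intro eqv_mult_left ghost_edge e x ghost)
  show ?case
  proof (cases "f = e")
    case True
    then have "x * gen (Ghost f) * gen (Edge e) \<approx> x * gen (Vertex (head G f))"
      using * by simp
    also have "\<dots> \<approx> x"
      using ghost by (intro ghost_filtered_vertex) auto
    finally show ?thesis using ghost True by (auto intro: ghost_filtered_eqv)
  next
    case False
    then show ?thesis using * by (auto simp: eqv_zero intro: ghost_filtered.ideal)
  qed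
qed (simp_all add: distrib_right mult_scale_left ghost_filtered.add ghost_filtered.scale
    ghost_filtered.ideal I_mult_right free_carrier_gen)

lemma ghost_filtered_gen_path:
  assumes q: "q \<in> paths_to G u" and g: "g \<in> lpa_gens G"
  shows "ghost_filtered (Suc n) u (gen g * path_monomial q)"
proof -
  obtain s p where sp: "q = (s, p)" "awalk s p u" using q by (cases q) auto
  then have s: "s \<in> verts G" and p: "set p \<subseteq> arcs G" by (auto simp: awalk_def)
  have *: "gen g * path_monomial q \<approx> (if s = right_vertex g then gen g else 0) * edges p"
    using eqv_mult_edges[OF gen_vertex[OF g s] p] by (simp add: sp mult.assoc)
  show ?thesis
  proof (cases "s = right_vertex g")
    case False
    then have "gen g * path_monomial q \<in> I" using * by (simp add: eqv_zero)
    then show ?thesis by (rule ghost_filtered.ideal)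
  next
    case True
    then have **: "gen g * path_monomial q \<approx> gen g * edges p" using * by simp
    have mono: "ghost_filtered (Suc n) u (gen (Vertex t) * edges r)" if "awalk t r u" for t r
      using ghost_filtered.path[of "(t, r)" u "Suc n"] that by simp
    have "ghost_filtered (Suc n) u (gen g * edges p)"
    proof (cases g)
      case (Vertex t)
      then show ?thesis using True sp mono by simp
    next
      case (Edge e)
      then have e: "e \<in> arcs G" "head G e = s" using g True by auto
      have "awalk (tail G e) (e # p) u" using e sp by (simp add: awalk_Cons_iff)
      from mono[OF this] eqv_mult_edges[OF eqv_sym[OF tail_edge[OF e(1)]] p] show ?thesis
        unfolding Edge by (auto simp: mult.assoc intro: ghost_filtered_eqv)
    next
      case (Ghost e)
      then have e: "e \<in> arcs G" "tail G e = s" using g True by auto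
      show ?thesis
      proof (cases p)
        case Nil
        have "ghost_filtered n (head G e) (gen (Vertex (head G e)) * edges [])"
          using ghost_filtered.path[of "(head G e, [])" "head G e" n] e by (simp add: awalk_Nil_iff)
        from ghost_filtered.ghost[OF e(1) this]
        have "ghost_filtered (Suc n) u (gen (Vertex (head G e)) * gen (Ghost e))"
          using sp e Nil by (simp add: awalk_Nil_iff)
        then show ?thesis
          using ghost_filtered_eqv eqv_sym[OF head_ghost[OF e(1)]] by (simp add: Ghost Nil)
      next
        case (Cons f p')
        then have f: "f \<in> arcs G" "set p' \<subseteq> arcs G" "awalk (head G f) p' u"
          using sp p by (auto simp: awalk_Cons_iff)
        have "gen (Ghost e) * edges p
            \<approx> (if e = f then gen (Vertex (head G e)) else 0) * edges p'"
          using eqv_mult_edges[OF ghost_edge[OF e(1) f(1)] f(2)] by (simp add: Cons mult.assoc)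
        moreover have "ghost_filtered (Suc n) u
            ((if e = f then gen (Vertex (head G e)) else 0) * edges p')"
          using mono[OF f(3)] by (auto intro: ghost_filtered.ideal I_zero)
        ultimately show ?thesis
          unfolding Ghost by (rule ghost_filtered_eqv[rotated])
      qed
    qed
    then show ?thesis using ** by (rule ghost_filtered_eqv)
  qed
qed

lemma ghost_filtered_gen:
  "ghost_filtered n u x \<Longrightarrow> g \<in> lpa_gens G \<Longrightarrow> ghost_filtered (Suc n) u (gen g * x)"
proof (induction rule: ghost_filtered.induct)
  case (path q u n)
  then show ?case by (rule ghost_filtered_gen_path)
next
  case (ghost f n x)
  then show ?case using ghost_filtered.ghost[of f "Suc n" "gen g * x"] by (simp add: mult.assoc)
qed (simp_all add: distrib_left mult_scale_right ghost_filtered.add ghost_filtered.scale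
    ghost_filtered.ideal I_mult_left free_carrier_gen)

text \<open>
  Starting from \<open>u\<close>, each further letter on the left raises the ghost degree by at most one.
\<close>

lemma ghost_filtered_exhausts:
  assumes x: "x \<in> lpa_carrier G" and u: "u \<in> verts G"
  shows "\<exists>n. ghost_filtered n u (x * gen (Vertex u))"
proof -
  have word: "ghost_filtered (length gs) u (prod_list (map gen gs) * gen (Vertex u))"
    if "set gs \<subseteq> lpa_gens G" for gs
    using that
  proof (induction gs)
    case Nil
    show ?case
      using ghost_filtered.path[of "(u, [])" u 0] u by (simp add: awalk_Nil_iff)
  next
    case (Cons g gs)
    then show ?case by (auto simp: mult.assoc intro: ghost_filtered_gen)
  qed
  let ?W = "Poly_Mapping.keys x"
  define n where "n = (\<Sum>w\<in>?W. length (letters w))"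
  have "ghost_filtered n u
      (\<Sum>w\<in>?W. scale (Poly_Mapping.lookup x w) (Poly_Mapping.single w 1 * gen (Vertex u)))"
  proof (intro ghost_filtered_sum ghost_filtered.scale)
    fix w assume w: "w \<in> ?W"
    then have "length (letters w) \<le> n"
      unfolding n_def by (intro member_le_sum) auto
    then show "ghost_filtered n u (Poly_Mapping.single w 1 * gen (Vertex u))"
      unfolding single_word
      by (rule ghost_filtered_mono[rotated]) (use x w word in \<open>auto simp: free_carrier_iff\<close>)
  qed
  moreover have "x * gen (Vertex u)
      = (\<Sum>w\<in>?W. scale (Poly_Mapping.lookup x w) (Poly_Mapping.single w 1 * gen (Vertex u)))"
    by (subst poly_mapping_expansion[of x]) (simp add: sum_distrib_right mult_scale_left)
  ultimately show ?thesis by auto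
qed

end


context leavitt_ideal
begin

text \<open>
  Sorting the monomials \<open>\<alpha> \<beta>\<^sup>*\<close> by the first edge of \<open>\<beta>\<close>. Only finitely many first edges \<open>\<Phi>\<close> occur; at an
  infinite emitter this leaves an edge outside \<open>\<Phi>\<close>.
\<close>

lemma ghost_filtered_decomposition:
  assumes "ghost_filtered n u x"
  shows "\<exists>c \<Phi> z. c \<in> path_space G u \<and> finite \<Phi> \<and> \<Phi> \<subseteq> out_arcs G u \<and> (n = 0 \<longrightarrow> \<Phi> = {}) \<and>
     (\<forall>f. z f \<in> lpa_carrier G) \<and> (\<forall>f. f \<notin> \<Phi> \<longrightarrow> z f = 0) \<and>
     x \<approx> path_combination c + (\<Sum>f\<in>\<Phi>. z f * gen (Ghost f))"
  using assms
proof (induction rule: ghost_filtered.induct)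
  case (path q u n)
  then show ?case
    by (intro exI[of _ "Poly_Mapping.single q 1"] exI[of _ "{}"] exI[of _ "\<lambda>_. 0"])
      (simp add: path_combination_def linear_extension_single free_carrier_zero)
next
  case (ghost f n x)
  then show ?case
    by (intro exI[of _ 0] exI[of _ "{f}"] exI[of _ "\<lambda>g. if g = f then x else 0"])
      (simp add: module_hom.zero[OF klinear_path_combination] free_carrier_zero
        ghost_filtered_in_carrier)
next
  case (add n u x y)
  from add.IH obtain c \<Phi> z where x: "c \<in> path_space G u" "finite \<Phi>" "\<Phi> \<subseteq> out_arcs G u"
    "n = 0 \<longrightarrow> \<Phi> = {}" "\<forall>f. z f \<in> lpa_carrier G" "\<forall>f. f \<notin> \<Phi> \<longrightarrow> z f = 0"
    "x \<approx> path_combination c + (\<Sum>f\<in>\<Phi>. z f * gen (Ghost f))" by blast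
  from add.IH obtain c' \<Psi> z' where y: "c' \<in> path_space G u" "finite \<Psi>" "\<Psi> \<subseteq> out_arcs G u"
    "n = 0 \<longrightarrow> \<Psi> = {}" "\<forall>f. z' f \<in> lpa_carrier G" "\<forall>f. f \<notin> \<Psi> \<longrightarrow> z' f = 0"
    "y \<approx> path_combination c' + (\<Sum>f\<in>\<Psi>. z' f * gen (Ghost f))" by blast
  have "(\<Sum>f\<in>\<Phi>. z f * gen (Ghost f)) = (\<Sum>f\<in>\<Phi> \<union> \<Psi>. z f * gen (Ghost f))"
    "(\<Sum>f\<in>\<Psi>. z' f * gen (Ghost f)) = (\<Sum>f\<in>\<Phi> \<union> \<Psi>. z' f * gen (Ghost f))"
    using x y by (intro sum.mono_neutral_left; auto)+
  then have "x + y \<approx> path_combination (c + c') + (\<Sum>f\<in>\<Phi> \<union> \<Psi>. (z f + z' f) * gen (Ghost f))"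
    using eqv_add[OF x(7) y(7)]
    by (simp add: module_hom.add[OF klinear_path_combination] distrib_right sum.distrib algebra_simps)
  moreover have "c + c' \<in> path_space G u"
    using x(1) y(1) Poly_Mapping.keys_add[of c c'] by auto
  ultimately show ?case
    using x y by (intro exI[of _ "c + c'"] exI[of _ "\<Phi> \<union> \<Psi>"] exI[of _ "\<lambda>f. z f + z' f"])
      (auto simp: free_carrier_add)
next
  case (scale n u x a)
  from scale.IH obtain c \<Phi> z where x: "c \<in> path_space G u" "finite \<Phi>" "\<Phi> \<subseteq> out_arcs G u"
    "n = 0 \<longrightarrow> \<Phi> = {}" "\<forall>f. z f \<in> lpa_carrier G" "\<forall>f. f \<notin> \<Phi> \<longrightarrow> z f = 0"
    "x \<approx> path_combination c + (\<Sum>f\<in>\<Phi>. z f * gen (Ghost f))" by blast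
  have "scale a x \<approx> path_combination (scale a c) + (\<Sum>f\<in>\<Phi>. scale a (z f) * gen (Ghost f))"
    using eqv_scale[OF x(7), of a]
    by (simp add: module_hom.scale[OF klinear_path_combination] mult_scale_left
        scale.scale_right_distrib scale.scale_sum_right)
  moreover have "scale a c \<in> path_space G u"
    using x(1) keys_scale_subset[of a c] by auto
  ultimately show ?case
    using x by (intro exI[of _ "scale a c"] exI[of _ \<Phi>] exI[of _ "\<lambda>f. scale a (z f)"])
      (auto simp: free_carrier_scale)
next
  case (ideal x n u)
  then show ?case
    by (intro exI[of _ 0] exI[of _ "{}"] exI[of _ "\<lambda>_. 0"])
      (simp add: module_hom.zero[OF klinear_path_combination] free_carrier_zero eqv_zero)
qed

lemma ghost_sum_edge:
  assumes z: "\<forall>f. z f \<in> lpa_carrier G" "\<forall>f. f \<notin> \<Phi> \<longrightarrow> z f = 0"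
    and \<Phi>: "finite \<Phi>" "\<Phi> \<subseteq> arcs G" and e: "e \<in> arcs G"
  shows "(\<Sum>f\<in>\<Phi>. z f * gen (Ghost f)) * gen (Edge e) \<approx> z e * gen (Vertex (head G e))"
proof -
  have "(\<Sum>f\<in>\<Phi>. z f * gen (Ghost f)) * gen (Edge e)
      = (\<Sum>f\<in>\<Phi>. z f * (gen (Ghost f) * gen (Edge e)))"
    by (simp add: sum_distrib_right mult.assoc)
  also have "\<dots> \<approx> (\<Sum>f\<in>\<Phi>. z f * (if f = e then gen (Vertex (head G f)) else 0))"
    using \<Phi> z e by (intro eqv_sum eqv_mult_left ghost_edge) auto
  also have "\<dots> = (\<Sum>f\<in>\<Phi>. if f = e then z f * gen (Vertex (head G f)) else 0)"
    by (intro sum.cong) auto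
  also have "\<dots> = z e * gen (Vertex (head G e))"
    using \<Phi>(1) z(2) by simp
  finally show ?thesis .
qed

end


section \<open>The annihilator of the space of paths\<close>

context wf_digraph
begin

text \<open>
  Let \<open>H\<close> be the set of vertices not above \<open>w\<close>. An element \<open>x\<close> of the annihilator with right vertex \<open>u\<close>
  lies in \<open>I\<close> by induction on the ghost degree. This is clear for \<open>u \<in> H\<close>. By the induction hypothesis
  \<open>x e\<close> lies in \<open>I\<close> for every edge \<open>e\<close> that \<open>u\<close> emits. If \<open>u \<noteq> w\<close> emits finitely many edges avoiding \<open>H\<close>,
  then \<open>u = \<Sum>e e\<^sup>*\<close> over these modulo \<open>I\<close>, hence \<open>x = \<Sum>(x e) e\<^sup>*\<close> is in \<open>I\<close>. In the other cases \<open>x\<close> also has a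
  part without ghost edges, which the \<open>x e\<close> do not control; it vanishes because it acts injectively on a
  suitable path to \<open>w\<close>.
\<close>

lemma path_annihilator_eq_ideal:
  fixes I :: "('a, 'b, 'k::field) lpa_free set"
  assumes ideal: "algebra_ideal (free_algebra (lpa_gens G)) I"
    and relations: "lpa_relations G \<subseteq> I"
    and I_ann: "I \<subseteq> path_annihilator G w"
    and vertices: "\<And>u. u \<in> not_above G w \<Longrightarrow> gen (Vertex u) \<in> I"
    and gaps: "\<And>u. \<lbrakk>u \<in> verts G; u \<notin> not_above G w; u \<noteq> w;
                 finite (out_arcs_avoiding G (not_above G w) u)\<rbrakk>
               \<Longrightarrow> free_gap G (not_above G w) u \<in> I"
  shows "path_annihilator G w = I"
proof
  interpret leavitt_ideal G I
    by unfold_locales (use ideal relations in auto)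
  let ?J = "path_annihilator G w :: ('a, 'b, 'k) lpa_free set"
  let ?H = "not_above G w"
  have J: "algebra_ideal (free_algebra (lpa_gens G)) ?J"
    by (rule algebra_ideal_path_annihilator)
  have J_right: "x * a \<in> ?J" if "x \<in> ?J" "a \<in> lpa_carrier G" for x a
    using J that unfolding free_ideal_iff by blast
  have J_eqv: "b \<in> ?J" if "a \<in> ?J" "a \<approx> b" for a b
  proof -
    have "b - a \<in> ?J" using eqv_sym[OF that(2)] I_ann by (auto simp: eqv_def)
    then have "a + (b - a) \<in> ?J" using J that(1) unfolding free_ideal_iff by blast
    then show ?thesis by simp
  qed
  have J_zero: "free_act G a (Poly_Mapping.single (s, p) 1) = 0" if "a \<in> ?J" "awalk s p w" for a s p
    using that by (auto simp: path_annihilator_iff)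
  have main: "x \<in> I" if "ghost_filtered n u x" "x \<in> ?J" "u \<in> verts G" for n u x
    using that
  proof (induction n arbitrary: u x)
    case 0
    show ?case
    proof (cases "u \<in> ?H")
      case True
      have "x * gen (Vertex u) \<in> I"
        using 0 True by (intro I_mult_left vertices ghost_filtered_in_carrier[OF 0(1)])
      then show ?thesis
        using eqv_mem eqv_sym[OF ghost_filtered_vertex] 0 by blast
    next
      case False
      then obtain p where p: "awalk u p w" using 0 not_above_iff by blast
      \<comment> \<open>In ghost degree \<open>0\<close> the injective action on any path from \<open>u\<close> to \<open>w\<close> suffices.\<close>
      obtain c where c: "c \<in> path_space G u" "x \<approx> path_combination c"
        using ghost_filtered_decomposition[OF 0(1)] by auto
      have "free_act G (path_combination c) (Poly_Mapping.single (u, p) 1) = 0"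
        using J_zero[OF J_eqv[OF 0(2) c(2)] p] .
      then have "c = 0" by (rule path_combination_acts_injectively[OF c(1)])
      then show ?thesis
        using c(2) by (simp add: module_hom.zero[OF klinear_path_combination] eqv_zero)
    qed
  next
    case (Suc n)
    have x: "x \<in> lpa_carrier G" and xu: "x \<approx> x * gen (Vertex u)"
      using Suc.prems ghost_filtered_in_carrier eqv_sym[OF ghost_filtered_vertex] by auto
    have xe: "x * gen (Edge e) \<in> I" if "e \<in> out_arcs G u" for e
    proof (rule Suc.IH)
      show "ghost_filtered n (head G e) (x * gen (Edge e))"
        using ghost_filtered_edge[OF Suc.prems(1) that] by simp
      show "x * gen (Edge e) \<in> ?J"
        using that by (intro J_right Suc.prems free_carrier_gen) auto
    qed (use that in auto)
    obtain c \<Phi> z where c: "c \<in> path_space G u"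
      and \<Phi>: "finite \<Phi>" "\<Phi> \<subseteq> out_arcs G u"
      and z: "\<forall>f. z f \<in> lpa_carrier G" "\<forall>f. f \<notin> \<Phi> \<longrightarrow> z f = 0"
      and dec: "x \<approx> path_combination c + (\<Sum>f\<in>\<Phi>. z f * gen (Ghost f))"
      using ghost_filtered_decomposition[OF Suc.prems(1)] by blast
    have \<Phi>_arcs: "\<Phi> \<subseteq> arcs G" using \<Phi>(2) by auto
    have c_carrier: "path_combination c \<in> lpa_carrier G"
      by (rule path_combination_in_carrier[OF c])
    let ?A = "out_arcs_avoiding G ?H u"
    have A: "?A \<subseteq> out_arcs G u" by (auto simp: out_arcs_avoiding_def)
    let ?P = "(\<Sum>e\<in>?A. gen (Edge e) * gen (Ghost e)) :: ('a, 'b, 'k) lpa_free"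
    have xP: "x * ?P \<in> I"
      unfolding sum_distrib_left mult.assoc[symmetric]
    proof (rule I_sum)
      fix e assume "e \<in> ?A"
      then have "e \<in> out_arcs G u" using A by auto
      then show "x * gen (Edge e) * gen (Ghost e) \<in> I"
        by (intro I_mult_right[OF free_carrier_gen xe]) auto
    qed
    have dec_edge: "x * gen (Edge e) \<approx> path_combination c * gen (Edge e)
        + z e * gen (Vertex (head G e))" if "e \<in> arcs G" for e
    proof -
      have "x * gen (Edge e) \<approx> path_combination c * gen (Edge e)
          + (\<Sum>f\<in>\<Phi>. z f * gen (Ghost f)) * gen (Edge e)"
        using eqv_mult_right[OF dec free_carrier_gen, of "Edge e"] that
        by (simp add: distrib_right)
      also have "\<dots> \<approx> path_combination c * gen (Edge e) + z e * gen (Vertex (head G e))"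
        by (intro eqv_add eqv_refl ghost_sum_edge z \<Phi> \<Phi>_arcs that)
      finally show ?thesis .
    qed
    consider "u \<in> ?H" | "infinite ?A" | "u \<notin> ?H" "finite ?A" "u \<noteq> w"
      | "u \<notin> ?H" "finite ?A" "u = w" by blast
    then show ?case
    proof cases
      case 1
      then have "x * gen (Vertex u) \<in> I" by (intro I_mult_left vertices x)
      then show ?thesis using eqv_mem xu by blast
    next
      case 2
      \<comment> \<open>An edge outside \<open>\<Phi>\<close> kills all terms with ghost edges, so \<open>x e\<close> sees only the part without them.
        Once that part is \<open>0\<close>, each remaining term is recovered from \<open>x f\<close>.\<close>
      then obtain e where e: "e \<in> ?A" "e \<notin> \<Phi>"
        using \<Phi>(1) finite_subset[of ?A \<Phi>] by blast
      then have e_arc: "e \<in> arcs G" "tail G e = u" "head G e \<notin> ?H"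
        by (auto simp: out_arcs_avoiding_def)
      then obtain p where p: "awalk (head G e) p w" using not_above_iff by force
      have "path_combination c * gen (Edge e) \<in> ?J"
      proof (rule J_eqv)
        show "x * gen (Edge e) \<in> ?J" using xe e A I_ann by blast
        show "x * gen (Edge e) \<approx> path_combination c * gen (Edge e)"
          using dec_edge[OF e_arc(1)] z(2) e(2) by simp
      qed
      from J_zero[OF this p] have "c = 0"
        using path_combination_acts_injectively[OF c, of "e # p"] e_arc
        by (simp add: free_act_mult free_act_edge)
      then have path_zero: "path_combination c = 0"
        by (simp add: module_hom.zero[OF klinear_path_combination])
      have "z f * gen (Ghost f) \<in> I" if f: "f \<in> \<Phi>" for f
      proof -
        have f_arc: "f \<in> arcs G" using f \<Phi>_arcs by auto
        have "z f * gen (Vertex (head G f)) \<approx> x * gen (Edge f)"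
          using eqv_sym[OF dec_edge[OF f_arc]] by (simp add: path_zero)
        then have "z f * gen (Vertex (head G f)) \<in> I"
          using eqv_mem xe f \<Phi>(2) by blast
        then have "z f * gen (Vertex (head G f)) * gen (Ghost f) \<in> I"
          using I_mult_right[of "gen (Ghost f)"] free_carrier_gen[of "Ghost f" "lpa_gens G"] f_arc by simp
        moreover have "z f * gen (Ghost f) \<approx> z f * (gen (Vertex (head G f)) * gen (Ghost f))"
          using z(1) by (intro eqv_mult_left eqv_sym[OF head_ghost] f_arc) auto
        ultimately show ?thesis using eqv_mem by (simp add: mult.assoc)
      qed
      then have "(\<Sum>f\<in>\<Phi>. z f * gen (Ghost f)) \<in> I" by (rule I_sum)
      then show ?thesis using eqv_mem[OF dec] by (simp add: path_zero)
    next
      case 3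
      have "x * free_gap G ?H u \<in> I"
        using 3 Suc.prems by (intro I_mult_left gaps x)
      then have "x * free_gap G ?H u + x * ?P \<in> I"
        using xP by (rule I_add)
      then show ?thesis
        using eqv_mem[OF xu] by (simp add: free_gap_def right_diff_distrib)
    next
      case 4
      \<comment> \<open>Here the projection \<open>g = w - \<Sum>e e\<^sup>*\<close> need not lie in \<open>I\<close>. It annihilates ghost edges from the right
        and fixes the path of length \<open>0\<close> at \<open>w\<close>, so \<open>x g\<close> is the part without ghost edges times \<open>g\<close>, and
        this part is tested on that path.\<close>
      let ?g = "free_gap G ?H u :: ('a, 'b, 'k) lpa_free"
      have A_arcs: "?A \<subseteq> arcs G" using A by auto
      have g: "?g \<in> lpa_carrier G"
        unfolding free_gap_def using Suc.prems(3) A_arcs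
        by (intro free_carrier_diff edge_projection_in_carrier free_carrier_gen) auto
      have ghost_g: "gen (Ghost f) * ?g \<in> I" if f: "f \<in> \<Phi>" for f
      proof -
        have f_arc: "f \<in> arcs G" "tail G f = u" using f \<Phi>(2) by auto
        have fP: "gen (Ghost f) * ?P \<approx> (if f \<in> ?A then gen (Ghost f) else 0)"
        proof -
          have "gen (Ghost f) * ?P = (\<Sum>e\<in>?A. gen (Ghost f) * gen (Edge e) * gen (Ghost e))"
            by (simp add: sum_distrib_left mult.assoc)
          also have "\<dots> \<approx> (\<Sum>e\<in>?A. (if f = e then gen (Vertex (head G f)) else 0) * gen (Ghost e))"
            using A_arcs f_arc by (intro eqv_sum eqv_mult_right ghost_edge free_carrier_gen) auto
          also have "\<dots> = (\<Sum>e\<in>?A. if e = f then gen (Vertex (head G f)) * gen (Ghost f) else 0)"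
            by (intro sum.cong) auto
          also have "\<dots> = (if f \<in> ?A then gen (Vertex (head G f)) * gen (Ghost f) else 0)"
            using 4 by simp
          also have "\<dots> \<approx> (if f \<in> ?A then gen (Ghost f) else 0)"
            using head_ghost[OF f_arc(1)] by simp
          finally show ?thesis .
        qed
        have "gen (Ghost f) * ?g = gen (Ghost f) * gen (Vertex (tail G f)) + - (gen (Ghost f) * ?P)"
          by (simp add: free_gap_def right_diff_distrib f_arc)
        also have "\<dots> \<approx> gen (Ghost f) + - (if f \<in> ?A then gen (Ghost f) else 0)"
          using eqv_add[OF ghost_tail[OF f_arc(1)] eqv_scale[OF fP, of "- 1"]] by simp
        also have "\<dots> \<approx> 0"
        proof (cases "f \<in> ?A")
          case False
          then have "head G f \<in> ?H" using f \<Phi>(2) by (auto simp: out_arcs_avoiding_def)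
          then have "gen (Vertex (head G f)) * gen (Ghost f) \<in> I"
            using f_arc by (intro I_mult_right vertices free_carrier_gen) auto
          then have "gen (Ghost f) \<in> I" using eqv_mem eqv_sym[OF head_ghost[OF f_arc(1)]] by blast
          then show ?thesis using False by (simp add: eqv_zero)
        qed simp
        finally show ?thesis by (simp add: eqv_zero)
      qed
      have xg: "x * ?g \<approx> path_combination c * ?g"
      proof -
        have "x * ?g \<approx> path_combination c * ?g + (\<Sum>f\<in>\<Phi>. z f * (gen (Ghost f) * ?g))"
          using eqv_mult_right[OF dec g] by (simp add: distrib_right sum_distrib_right mult.assoc)
        also have "\<dots> \<approx> path_combination c * ?g + 0"
          using z(1) by (intro eqv_add eqv_refl, unfold eqv_zero)
            (intro I_sum I_mult_left[OF _ ghost_g], simp_all)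
        finally show ?thesis by simp
      qed
      have w: "awalk w [] w" using 4 Suc.prems by (simp add: awalk_Nil_iff)
      have "free_act G (path_combination c * ?g) (Poly_Mapping.single (w, []) 1) = 0"
        by (rule J_zero[OF J_eqv[OF J_right[OF Suc.prems(2) g] xg] w])
      moreover have "free_act G ?g (Poly_Mapping.single (w, []) 1) = Poly_Mapping.single (w, []) 1"
        using free_act_edge_projection[OF w 4(2) A_arcs] 4
        by (simp add: free_gap_def module_hom.diff[OF klinear_free_act_left] free_act_vertex)
      ultimately have "c = 0"
        using path_combination_acts_injectively[OF c, of "[]"] 4 by (simp add: free_act_mult)
      then have "x * ?g \<in> I"
        using xg by (simp add: module_hom.zero[OF klinear_path_combination] eqv_zero)
      then have "x * ?g + x * ?P \<in> I" using xP by (rule I_add)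
      then show ?thesis
        using eqv_mem[OF xu] by (simp add: free_gap_def right_diff_distrib)
    qed
  qed
  show "?J \<subseteq> I"
  proof
    fix x assume x: "x \<in> ?J"
    then have "x \<in> lpa_carrier G" by (simp add: path_annihilator_def)
    then obtain U where U: "U \<subseteq> verts G" "x \<approx> (\<Sum>u\<in>U. x * gen (Vertex u))"
      and filtered: "\<And>u. u \<in> verts G \<Longrightarrow> \<exists>n. ghost_filtered n u (x * gen (Vertex u))"
      using right_units ghost_filtered_exhausts by metis
    have "x * gen (Vertex u) \<in> I" if "u \<in> U" for u
    proof -
      have u: "u \<in> verts G" using that U(1) by auto
      then obtain n where "ghost_filtered n u (x * gen (Vertex u))" using filtered by blast
      then show ?thesis
        using u by (intro main[of n u] J_right[OF x free_carrier_gen]) auto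
    qed
    then show "x \<in> I" by (intro eqv_mem[OF U(2)] I_sum)
  qed
qed (rule I_ann)

text \<open>
  This has two uses. For the original graph it gives \<open>I(H,S)\<close>; for the
  quotient graph, in which every vertex lies above the sink \<open>v'\<close>, the generators beyond the Leavitt relations
  disappear and the module of the sink is faithful.
\<close>

theorem path_annihilator_eq_ideal_gen:
  assumes w: "\<not> regular_vertex G w"
  defines "H \<equiv> not_above G w"
  shows "(path_annihilator G w :: ('a, 'b, 'k::field) lpa_free set) =
     ideal_gen (free_algebra (lpa_gens G))
       (lpa_relations G \<union> gap_generators G H (breaking_vertices G H - {w}))"
proof (rule path_annihilator_eq_ideal)
  let ?X = "lpa_relations G \<union> gap_generators G H (breaking_vertices G H - {w})
      :: ('a, 'b, 'k) lpa_free set"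
  let ?I = "ideal_gen (free_algebra (lpa_gens G)) ?X"
  have X: "?X \<subseteq> ?I" by (rule ideal_gen_superset)
  have XC: "?X \<subseteq> lpa_carrier G"
    using lpa_relations_in_carrier gap_generators_in_carrier[of H "breaking_vertices G H - {w}"]
    by (auto simp: H_def not_above_def breaking_vertices_def)
  show I: "algebra_ideal (free_algebra (lpa_gens G)) ?I"
    by (rule algebra_ideal_ideal_gen[OF XC])
  show relations: "lpa_relations G \<subseteq> ?I" using X by auto
  show "?I \<subseteq> path_annihilator G w"
    using lpa_relations_annihilate[OF w] gap_generators_annihilate[of w]
    by (intro ideal_gen_least algebra_ideal_path_annihilator) (simp add: H_def)
  interpret leavitt_ideal G ?I
    by unfold_locales (use I relations in auto)
  show vertices: "gen (Vertex u) \<in> ?I" if "u \<in> not_above G w" for u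
    using that X by (auto simp: gap_generators_def H_def)
  show "free_gap G (not_above G w) u \<in> ?I"
    if u: "u \<in> verts G" "u \<notin> not_above G w" "u \<noteq> w"
      and fin: "finite (out_arcs_avoiding G (not_above G w) u)" for u
  proof -
    let ?A = "out_arcs_avoiding G H u"
    obtain p where "awalk u p w" using u not_above_iff by blast
    then obtain e p' where "awalk u (e # p') w"
      using u(3) by (cases p) (auto simp: awalk_Nil_iff)
    then have e: "e \<in> ?A"
      using awalk_source_not_above by (auto simp: out_arcs_avoiding_def awalk_Cons_iff H_def)
    \<comment> \<open>A vertex \<open>u \<noteq> w\<close> above \<open>w\<close> is regular or breaking. For regular \<open>u\<close>, edges into \<open>H\<close> lie in the ideal,
      so the regular relation can be cut down to the edges that avoid \<open>H\<close>.\<close>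
    show ?thesis
    proof (cases "finite (out_arcs G u)")
      case False
      then have "u \<in> breaking_vertices G H"
        using u fin e card_gt_0_iff[of ?A]
        by (auto simp: breaking_vertices_def infinite_emitter_def H_def)
      then show ?thesis using u X by (auto simp: gap_generators_def H_def)
    next
      case True
      have "regular_vertex G u"
        using True e u by (auto simp: regular_vertex_def out_arcs_avoiding_def)
      then have "gen (Vertex u) - (\<Sum>e\<in>out_arcs G u. gen (Edge e) * gen (Ghost e)) \<in> ?I"
        using relations by (auto simp: lpa_relations_def)
      moreover have "gen (Edge f) * gen (Ghost f) \<in> ?I" if f: "f \<in> out_arcs G u - ?A" for f
      proof -
        have f: "f \<in> arcs G" "head G f \<in> not_above G w"
          using f by (auto simp: out_arcs_avoiding_def H_def)
        have "gen (Edge f) * gen (Vertex (head G f)) \<in> ?I"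
          using f by (intro I_mult_left vertices free_carrier_gen) auto
        then have "gen (Edge f) \<in> ?I" using eqv_mem eqv_sym[OF edge_head[OF f(1)]] by blast
        then show ?thesis using f by (intro I_mult_right free_carrier_gen) auto
      qed
      then have "(\<Sum>f\<in>out_arcs G u - ?A. gen (Edge f) * gen (Ghost f)) \<in> ?I" by (rule I_sum)
      ultimately have "(gen (Vertex u) - (\<Sum>e\<in>out_arcs G u. gen (Edge e) * gen (Ghost e)))
          + (\<Sum>f\<in>out_arcs G u - ?A. gen (Edge f) * gen (Ghost f)) \<in> ?I"
        by (rule I_add)
      moreover have "(\<Sum>f\<in>out_arcs G u. gen (Edge f) * gen (Ghost f))
          = (\<Sum>f\<in>out_arcs G u - ?A. gen (Edge f) * gen (Ghost f))
            + (\<Sum>f\<in>?A. gen (Edge f) * gen (Ghost f) :: ('a, 'b, 'k) lpa_free)"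
        using True by (intro sum.subset_diff) (auto simp: out_arcs_avoiding_def)
      then have "free_gap G (not_above G w) u
          = (gen (Vertex u) - (\<Sum>e\<in>out_arcs G u. gen (Edge e) * gen (Ghost e)))
            + (\<Sum>f\<in>out_arcs G u - ?A. gen (Edge f) * gen (Ghost f) :: ('a, 'b, 'k) lpa_free)"
        by (simp add: free_gap_def H_def)
      ultimately show ?thesis by simp
    qed
  qed
qed

end


section \<open>Paths in the quotient graph\<close>

lemma breaking_vertices_empty: "breaking_vertices G {} = {}"
proof -
  have "out_arcs_avoiding G {} u = out_arcs G u" for u
    by (simp add: out_arcs_avoiding_def out_arcs_def)
  then show ?thesis by (auto simp: breaking_vertices_def infinite_emitter_def)
qed

locale breaking_vertex = wf_digraph E for E :: "('v, 'e) pre_digraph" +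
  fixes v :: 'v
  assumes v_breaking: "v \<in> breaking_vertices E (not_above E v)"
begin

abbreviation "H \<equiv> not_above E v"
abbreviation "S \<equiv> breaking_vertices E H - {v}"
abbreviation "F \<equiv> quotient_graph E H S"

lemma v_in_verts: "v \<in> verts E"
  using v_breaking by (simp add: breaking_vertices_def)

lemma breaking_minus_S: "breaking_vertices E H - S = {v}"
  using v_breaking by auto

lemma head_not_above: "e \<in> arcs E \<Longrightarrow> head E e \<notin> H \<Longrightarrow> tail E e \<notin> H"
proof -
  assume e: "e \<in> arcs E" "head E e \<notin> H"
  then obtain p where "awalk (head E e) p v" using not_above_iff by force
  then have "awalk (tail E e) (e # p) v" using e by (simp add: awalk_Cons_iff)
  then show ?thesis by (rule awalk_source_not_above)
qed

lemma v_not_above: "v \<notin> H"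
  using awalk_source_not_above[of v "[]" v] v_in_verts by (simp add: awalk_Nil_iff)

lemma
  shows verts_F: "verts F = Orig ` (verts E - H) \<union> {Primed v}"
    and arcs_F: "arcs F = Orig ` {e \<in> arcs E. head E e \<notin> H} \<union> Primed ` {e \<in> arcs E. head E e = v}"
    and ends_F [simp]: "tail F (Orig e) = Orig (tail E e)" "tail F (Primed e) = Orig (tail E e)"
      "head F (Orig e) = Orig (head E e)" "head F (Primed e) = Primed (head E e)"
  by (simp_all only: quotient_graph_def breaking_minus_S) simp_all

lemma verts_F_iff [simp]:
  "Orig u \<in> verts F \<longleftrightarrow> u \<in> verts E \<and> u \<notin> H" "Primed u \<in> verts F \<longleftrightarrow> u = v"
  unfolding verts_F by auto

lemma arcs_F_iff [simp]:
  "Orig e \<in> arcs F \<longleftrightarrow> e \<in> arcs E \<and> head E e \<notin> H"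
  "Primed e \<in> arcs F \<longleftrightarrow> e \<in> arcs E \<and> head E e = v"
  unfolding arcs_F by auto

lemma wf_F: "wf_digraph F"
proof
  fix a assume a: "a \<in> arcs F"
  show "tail F a \<in> verts F"
    using a head_not_above v_not_above by (cases a) (simp_all)
  show "head F a \<in> verts F"
    using a by (cases a) simp_all
qed

sublocale F: wf_digraph F
  by (rule wf_F)

text \<open>
  A path of the quotient graph that ends in the sink \<open>v'\<close> is a path to \<open>v\<close> with its last edge primed, or with
  its only vertex primed if it has no edges.
\<close>

primrec prime_edges :: "'e list \<Rightarrow> 'e primed list" where
  "prime_edges [] = []"
| "prime_edges (e # p) = (if p = [] then Primed e else Orig e) # prime_edges p"

fun prime_path :: "('v, 'e) path \<Rightarrow> ('v primed, 'e primed) path" where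
  "prime_path (u, p) = ((if p = [] then Primed u else Orig u), prime_edges p)"

lemma prime_edges_Nil_iff [simp]: "prime_edges p = [] \<longleftrightarrow> p = []"
  by (cases p) auto

lemma prime_edges_inject: "prime_edges p = prime_edges q \<Longrightarrow> p = q"
proof (induction p arbitrary: q)
  case Nil
  then show ?case by (cases q) auto
next
  case (Cons e p)
  then show ?case by (cases q) (auto split: if_splits)
qed

lemma inj_prime_path: "inj prime_path"
  by (auto simp: inj_def split: if_splits dest: prime_edges_inject)

lemma prime_path_in_paths_to: "awalk u p v \<Longrightarrow> prime_path (u, p) \<in> paths_to F (Primed v)"
proof (induction p arbitrary: u)
  case Nil
  then show ?case by (simp add: F.awalk_Nil_iff awalk_Nil_iff)
next
  case (Cons e p)
  then have e: "e \<in> arcs E" "tail E e = u" "awalk (head E e) p v"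
    by (simp_all add: awalk_Cons_iff)
  then have "head E e \<notin> H" "p = [] \<Longrightarrow> head E e = v"
    using awalk_source_not_above by (auto simp: awalk_Nil_iff)
  then show ?case
    using Cons.IH[OF e(3)] e by (cases "p = []") (simp_all add: F.awalk_Cons_iff)
qed

lemma paths_to_F: "paths_to F (Primed v) = prime_path ` paths_to E v"
proof
  show "prime_path ` paths_to E v \<subseteq> paths_to F (Primed v)"
    using prime_path_in_paths_to by (force simp del: prime_path.simps)
  have "(x, r) \<in> prime_path ` paths_to E v" if "F.awalk x r (Primed v)" for x r
    using that
  proof (induction r arbitrary: x)
    case Nil
    then show ?case
      using v_in_verts
      by (intro image_eqI[of _ _ "(v, [])"]) (simp_all add: F.awalk_Nil_iff awalk_Nil_iff)
  next
    case (Cons a r)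
    then have a: "a \<in> arcs F" "tail F a = x" "F.awalk (head F a) r (Primed v)"
      by (simp_all add: F.awalk_Cons_iff)
    obtain q where "q \<in> paths_to E v" "(head F a, r) = prime_path q"
      using Cons.IH[OF a(3)] by blast
    then obtain u p where p: "awalk u p v" "(head F a, r) = prime_path (u, p)"
      by (cases q) simp
    obtain e where e: "e \<in> arcs E" "a = (if p = [] then Primed e else Orig e)" "head E e = u"
      using a(1) p(2) by (cases a) (simp_all split: if_splits)
    then have "awalk (tail E e) (e # p) v" "(x, a # r) = prime_path (tail E e, e # p)"
      using p a(2) by (cases "p = []"; simp add: awalk_Cons_iff)+
    then show ?case by (intro image_eqI[of _ _ "(tail E e, e # p)"]) simp_all
  qed
  then show "paths_to F (Primed v) \<subseteq> prime_path ` paths_to E v"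
    by (force simp del: prime_path.simps)
qed

text \<open>
  To reach \<open>v'\<close> from a vertex of the original graph, a path to \<open>v\<close> with at least one edge is needed. For \<open>v\<close>
  itself one exists because the breaking vertex \<open>v\<close> emits an edge into a vertex above \<open>v\<close>.
\<close>

lemma not_above_F: "not_above F (Primed v) = {}"
proof -
  have "\<exists>p. F.awalk x p (Primed v)" if x: "x \<in> verts F" for x
  proof (cases x)
    case (Primed u)
    then show ?thesis using x by (intro exI[of _ "[]"]) (simp add: F.awalk_Nil_iff)
  next
    case (Orig u)
    then obtain p where p: "awalk u p v" using x not_above_iff by auto
    have "\<exists>q. awalk u q v \<and> q \<noteq> []"
    proof (cases "p = []")
      case True
      have "out_arcs_avoiding E H v \<noteq> {}"
        using v_breaking by (auto simp: breaking_vertices_def)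
      then obtain e where e: "e \<in> arcs E" "tail E e = v" "head E e \<notin> H"
        by (auto simp: out_arcs_avoiding_def)
      then obtain q where "awalk (head E e) q v" using not_above_iff by force
      then have "awalk u (e # q) v" using p True e by (auto simp: awalk_Cons_iff awalk_Nil_iff)
      then show ?thesis by blast
    qed (use p in blast)
    then obtain q where "awalk u q v" "q \<noteq> []" by blast
    then show ?thesis
      using prime_path_in_paths_to[of u q] Orig by (intro exI[of _ "prime_edges q"]) simp
  qed
  then have "x \<notin> not_above F (Primed v)" if "x \<in> verts F" for x
    using F.not_above_iff that by blast
  moreover have "not_above F (Primed v) \<subseteq> verts F" by (auto simp: not_above_def[of F])
  ultimately show ?thesis by blast
qed

text \<open>
  Faithfulness of the module of the sink \<open>v'\<close> over the Leavitt path algebra of the quotient graph.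
\<close>

lemma path_annihilator_F:
  "(path_annihilator F (Primed v) :: ('v primed, 'e primed, 'k::field) lpa_free set)
     = lpa_relation_ideal F"
proof -
  have "a \<notin> out_arcs F (Primed v)" for a
    by (cases a) simp_all
  then have "out_arcs F (Primed v) = {}" by blast
  then have "\<not> regular_vertex F (Primed v)" by (simp add: regular_vertex_def)
  then show ?thesis
    using F.path_annihilator_eq_ideal_gen[of "Primed v"]
    by (simp add: not_above_F breaking_vertices_empty gap_generators_def lpa_relation_ideal_def lpa_free_algebra_eq)
qed


section \<open>The quotient map and the two spaces of paths\<close>

abbreviation quotient_hom ::
    "('v, 'e, 'k::field) lpa_free \<Rightarrow> ('v primed, 'e primed, 'k) lpa_free" where
  "quotient_hom \<equiv> free_lift (quotient_gen E H S)"

lemma quotient_hom_eq: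
  "quotient_hom a = linear_extension (\<lambda>w. prod_list (map (quotient_gen E H S) (letters w))) a"
  by (simp add: free_lift_def linear_extension_def)

lemma klinear_quotient_hom: "klinear (quotient_hom :: ('v, 'e, 'k::field) lpa_free \<Rightarrow> _)"
  unfolding quotient_hom_eq by (rule klinear_linear_extension)

lemma quotient_gen_eq:
  "quotient_gen E H S (Vertex u) =
     (if u \<in> H then 0
      else if u = v then gen (Vertex (Orig u)) + gen (Vertex (Primed u))
      else gen (Vertex (Orig u)))"
  "quotient_gen E H S (Edge e) =
     (if head E e \<in> H then 0
      else if head E e = v then gen (Edge (Orig e)) + gen (Edge (Primed e))
      else gen (Edge (Orig e)))"
  "quotient_gen E H S (Ghost e) =
     (if head E e \<in> H then 0
      else if head E e = v then gen (Ghost (Orig e)) + gen (Ghost (Primed e))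
      else gen (Ghost (Orig e)))"
  by (simp_all only: quotient_gen.simps breaking_minus_S singleton_iff)

lemma quotient_gen_in_carrier: "g \<in> lpa_gens E \<Longrightarrow> quotient_gen E H S g \<in> lpa_carrier F"
  by (cases g) (simp_all add: quotient_gen_eq free_carrier_closed v_in_verts del: quotient_gen.simps)

lemma quotient_hom_in_carrier:
  assumes "a \<in> lpa_carrier E"
  shows "quotient_hom a \<in> lpa_carrier F"
  unfolding quotient_hom_eq linear_extension_def
  using assms quotient_gen_in_carrier
  by (intro free_carrier_sum free_carrier_scale free_carrier_prod_list)
    (auto simp: free_carrier_iff[of a] subset_iff)

definition prime_paths :: "(('v, 'e) path \<Rightarrow>\<^sub>0 'k::field) \<Rightarrow> (('v primed, 'e primed) path \<Rightarrow>\<^sub>0 'k)" where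
  "prime_paths = linear_extension (\<lambda>q. Poly_Mapping.single (prime_path q) 1)"

lemma klinear_prime_paths: "klinear prime_paths"
  unfolding prime_paths_def by (rule klinear_linear_extension)

lemma prime_paths_single:
  "prime_paths (Poly_Mapping.single q 1) = Poly_Mapping.single (prime_path q) 1"
  by (simp add: prime_paths_def linear_extension_single)

lemma prime_paths_single_path:
  "prime_paths (single_path x) = single_path (map_option prime_path x)"
  by (auto simp: prime_paths_single module_hom.zero[OF klinear_prime_paths] split: option.split
      simp del: prime_path.simps)

text \<open>
  Of the two summands \<open>e + e'\<close> with \<open>r(e) = v\<close>, the primed one extends only the path \<open>v'\<close> and the other one
  only the longer paths. So together they extend every path to \<open>v\<close>, primed at its end, as \<open>e\<close> does in the
  original graph.
\<close>

lemma quotient_gen_act_path: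
  assumes g: "g \<in> lpa_gens E" and q: "q \<in> paths_to E v"
  shows "free_act F (quotient_gen E H S g) (Poly_Mapping.single (prime_path q) 1)
       = prime_paths (gen_act E g (Poly_Mapping.single q (1::'k::field)))"
proof -
  obtain s p where sp: "q = (s, p)" "awalk s p v" using q by (cases q) auto
  have s: "s \<notin> H" and Nil: "p = [] \<Longrightarrow> s = v"
    using sp awalk_source_not_above by (auto simp: awalk_Nil_iff)
  have Cons: "head E f \<notin> H \<and> (r = [] \<longrightarrow> head E f = v)" if "p = f # r" for f r
    using sp that awalk_source_not_above by (auto simp: awalk_Cons_iff awalk_Nil_iff)
  show ?thesis
    unfolding gen_act_single prime_paths_single_path sp(1)
    using s Nil Cons
    by (cases g; cases p)
      (auto simp: quotient_gen_eq free_act_simps F.free_act_path simp del: quotient_gen.simps)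
qed

lemma quotient_word_act:
  assumes "set gs \<subseteq> lpa_gens E" "f \<in> path_space E v"
  shows "free_act F (prod_list (map (quotient_gen E H S) gs)) (prime_paths f)
       = prime_paths (foldr (gen_act E) gs f)"
  using assms(1)
proof (induction gs)
  case Nil
  show ?case using free_act_word[of F 0 "prime_paths f"] by simp
next
  case (Cons g gs)
  let ?h = "foldr (gen_act E) gs f"
  have h: "?h \<in> path_space E v"
    using Cons.prems assms(2) by (intro foldr_gen_act_path_space) auto
  have "free_act F (quotient_gen E H S g) (prime_paths ?h) = prime_paths (gen_act E g ?h)"
  proof (rule klinear_eq_on_basis[where f = ?h])
    show "klinear (\<lambda>h. free_act F (quotient_gen E H S g) (prime_paths h))"
      by (rule klinearI) (simp_all add: free_act_simps module_hom.add[OF klinear_prime_paths]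
          module_hom.scale[OF klinear_prime_paths])
    show "klinear (\<lambda>h. prime_paths (gen_act E g h))"
      by (rule klinearI) (simp_all add: module_hom.add[OF klinear_prime_paths]
          module_hom.scale[OF klinear_prime_paths] module_hom.add[OF klinear_gen_act]
          module_hom.scale[OF klinear_gen_act])
    fix q assume "q \<in> Poly_Mapping.keys ?h"
    then show "free_act F (quotient_gen E H S g) (prime_paths (Poly_Mapping.single q 1))
        = prime_paths (gen_act E g (Poly_Mapping.single q 1))"
      using quotient_gen_act_path[of g q] h Cons.prems
      by (auto simp: prime_paths_single simp del: prime_path.simps)
  qed
  then show ?case using Cons by (simp add: free_act_mult)
qed

lemma quotient_hom_act:
  assumes a: "a \<in> lpa_carrier E" and f: "f \<in> path_space E v"
  shows "free_act F (quotient_hom a) (prime_paths f) = prime_paths (free_act E a f)"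
proof (rule klinear_eq_on_basis[where f = a])
  show "klinear (\<lambda>a. free_act F (quotient_hom a) (prime_paths f))"
    by (rule klinearI) (simp_all add: free_act_simps module_hom.add[OF klinear_quotient_hom]
        module_hom.scale[OF klinear_quotient_hom])
  show "klinear (\<lambda>a. prime_paths (free_act E a f))"
    by (rule klinearI) (simp_all add: free_act_simps module_hom.add[OF klinear_prime_paths]
        module_hom.scale[OF klinear_prime_paths])
  fix w assume "w \<in> Poly_Mapping.keys a"
  then show "free_act F (quotient_hom (Poly_Mapping.single w 1)) (prime_paths f)
      = prime_paths (free_act E (Poly_Mapping.single w 1) f)"
    using quotient_word_act[OF _ f, of "letters w"] a
    by (simp add: quotient_hom_eq linear_extension_single free_act_word free_carrier_iff)
qed

text \<open>
  The module of \<open>v'\<close>, pulled back to the original graph, is the space of paths to \<open>v\<close>.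
\<close>

lemma quotient_hom_annihilates_iff:
  assumes a: "a \<in> lpa_carrier E"
  shows "quotient_hom a \<in> path_annihilator F (Primed v) \<longleftrightarrow> a \<in> path_annihilator E v"
proof -
  have "free_act F (quotient_hom a) (Poly_Mapping.single (prime_path q) 1) = 0
      \<longleftrightarrow> free_act E a (Poly_Mapping.single q 1) = 0" if "q \<in> paths_to E v" for q
  proof -
    have "free_act F (quotient_hom a) (Poly_Mapping.single (prime_path q) 1)
        = prime_paths (free_act E a (Poly_Mapping.single q 1))"
      using quotient_hom_act[OF a, of "Poly_Mapping.single q 1"] that
      by (simp add: prime_paths_single del: prime_path.simps)
    moreover have "prime_paths h = 0 \<longleftrightarrow> h = 0" for h :: "('v, 'e) path \<Rightarrow>\<^sub>0 'a"
      using linear_extension_injective[OF inj_prime_path, of h]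
        module_hom.zero[OF klinear_prime_paths] by (auto simp: prime_paths_def)
    ultimately show ?thesis by simp
  qed
  then show ?thesis
    using a quotient_hom_in_carrier[OF a]
    by (simp add: path_annihilator_iff paths_to_F del: prime_path.simps)
qed

end


section \<open>The annihilator of the breaking module\<close>

lemma (in wf_digraph) free_quotient_lpa: "free_quotient (lpa_gens G) (lpa_relation_ideal G)"
  unfolding lpa_relation_ideal_def lpa_free_algebra_eq
  by unfold_locales (rule algebra_ideal_ideal_gen[OF lpa_relations_in_carrier])

lemma (in wf_digraph) relation_ideal_annihilates:
  "\<not> regular_vertex G w \<Longrightarrow> lpa_relation_ideal G \<subseteq> path_annihilator G w"
  unfolding lpa_relation_ideal_def lpa_free_algebra_eq
  by (intro ideal_gen_least algebra_ideal_path_annihilator lpa_relations_annihilate)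

lemma graded_ideal_eq:
  "graded_ideal G H S = ideal_gen (leavitt_path_algebra G) (lpa_class G ` gap_generators G H S)"
  by (simp add: graded_ideal_def gap_generators_def image_Un image_image gap_element_def free_gap_def)

context breaking_vertex
begin

text \<open>
  The quotient map is well defined on cosets by faithfulness: the relations of the original graph annihilate
  the paths to \<open>v\<close>, so their images annihilate the module of \<open>v'\<close> and are therefore relations of the quotient
  graph. This replaces a verification for every type of relation.
\<close>

lemma breaking_module_smult:
  fixes a :: "('v, 'e, 'k::field) lpa_free"
  assumes a: "a \<in> lpa_carrier E" and f: "f \<in> path_space F (Primed v)"
  shows "lpa_class E a \<odot>\<^bsub>breaking_module E v\<^esub> f = free_act F (quotient_hom a) f"
proof -
  interpret QE: free_quotient "lpa_gens E" "lpa_relation_ideal E :: ('v, 'e, 'k) lpa_free set"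
    by (rule free_quotient_lpa)
  interpret QF: free_quotient "lpa_gens F"
    "lpa_relation_ideal F :: ('v primed, 'e primed, 'k) lpa_free set"
    by (rule F.free_quotient_lpa)
  have v_irregular: "\<not> regular_vertex E v"
    using v_breaking by (auto simp: breaking_vertices_def infinite_emitter_def regular_vertex_def)
  have "lpa_quotient_map E H S (lpa_class E a) = lpa_class F (quotient_hom a)"
    unfolding lpa_quotient_map_def lpa_class_def[of E] lpa_free_algebra_eq[of E]
  proof (rule QE.on_coset_cls[OF _ a])
    fix x :: "('v, 'e, 'k) lpa_free"
    assume x: "x \<in> lpa_carrier E" "x - a \<in> lpa_relation_ideal E"
    then have "quotient_hom (x - a) \<in> lpa_relation_ideal F"
      using relation_ideal_annihilates[OF v_irregular] quotient_hom_annihilates_iff[of "x - a"] a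
      by (auto simp: path_annihilator_F free_carrier_diff)
    then show "lpa_class F (quotient_hom x) = lpa_class F (quotient_hom a)"
      by (simp add: lpa_class_def lpa_free_algebra_eq QF.cls_eq_iff
          module_hom.diff[OF klinear_quotient_hom])
  qed
  moreover have "on_coset (\<lambda>b. free_act F b f) (lpa_class F (quotient_hom a))
      = free_act F (quotient_hom a) f"
    unfolding lpa_class_def lpa_free_algebra_eq
  proof (rule QF.on_coset_cls[OF _ quotient_hom_in_carrier[OF a]])
    fix b :: "('v primed, 'e primed, 'k) lpa_free"
    assume "b - quotient_hom a \<in> lpa_relation_ideal F"
    then have "free_act F (b - quotient_hom a) f = 0"
      using f unfolding path_annihilator_F[symmetric] path_annihilator_def by blast
    then show "free_act F b f = free_act F (quotient_hom a) f"
      by (simp add: free_act_simps)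
  qed
  ultimately show ?thesis
    by (simp add: breaking_module_def Let_def restrict_scalars_def sink_module_def)
qed

lemma class_annihilates_iff:
  fixes a :: "('v, 'e, 'k::field) lpa_free"
  assumes a: "a \<in> lpa_carrier E"
  shows "(\<forall>f\<in>carrier (breaking_module E v). lpa_class E a \<odot>\<^bsub>breaking_module E v\<^esub> f
            = \<zero>\<^bsub>breaking_module E v\<^esub>)
     \<longleftrightarrow> a \<in> path_annihilator E v"
    (is "?L \<longleftrightarrow> _")
proof -
  let ?N = "breaking_module E v
    :: (('v, 'e, 'k) lpa, ('v primed, 'e primed) path \<Rightarrow>\<^sub>0 'k) module"
  have N: "carrier ?N = path_space F (Primed v)" "\<zero>\<^bsub>?N\<^esub> = 0"
    by (simp_all add: breaking_module_def Let_def restrict_scalars_def sink_module_def)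
  have "?L \<longleftrightarrow> (\<forall>f\<in>path_space F (Primed v). free_act F (quotient_hom a) f = 0)"
    unfolding N by (intro ball_cong refl) (simp add: breaking_module_smult[OF a])
  also have "\<dots> \<longleftrightarrow> quotient_hom a \<in> path_annihilator F (Primed v)"
    using quotient_hom_in_carrier[OF a] by (simp add: path_annihilator_def)
  also have "\<dots> \<longleftrightarrow> a \<in> path_annihilator E v"
    by (rule quotient_hom_annihilates_iff[OF a])
  finally show ?thesis .
qed

lemma annihilator_breaking_module:
  "annihilator (leavitt_path_algebra E :: ('k::field, ('v, 'e, 'k) lpa) module) (breaking_module E v)
     = graded_ideal E H S"
proof -
  let ?R = "lpa_relation_ideal E :: ('v, 'e, 'k) lpa_free set"
  interpret QE: free_quotient "lpa_gens E" ?R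
    by (rule free_quotient_lpa)
  have class_eq: "lpa_class E a = QE.cls a" for a :: "('v, 'e, 'k) lpa_free"
    by (simp add: lpa_class_def lpa_free_algebra_eq)
  have lpa_eq: "leavitt_path_algebra E = QE.Q"
    by (simp add: leavitt_path_algebra_def lpa_free_algebra_eq)
  have gens: "(gap_generators E H S :: ('v, 'e, 'k) lpa_free set) \<subseteq> lpa_carrier E"
    by (rule gap_generators_in_carrier) (auto simp: not_above_def breaking_vertices_def)
  have v_irregular: "\<not> regular_vertex E v"
    using v_breaking by (auto simp: breaking_vertices_def infinite_emitter_def regular_vertex_def)
  have iff: "QE.cls a \<in> annihilator QE.Q (breaking_module E v) \<longleftrightarrow> QE.cls a \<in> graded_ideal E H S"
    if a: "a \<in> lpa_carrier E" for a
  proof -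
    have "QE.cls a \<in> annihilator QE.Q (breaking_module E v) \<longleftrightarrow> a \<in> path_annihilator E v"
      using class_annihilates_iff[OF a] a by (auto simp: annihilator_def class_eq QE.carrier_Q)
    also have "\<dots> \<longleftrightarrow> QE.cls a \<in> graded_ideal E H S"
      unfolding graded_ideal_eq lpa_eq class_eq path_annihilator_eq_ideal_gen[OF v_irregular]
      by (rule QE.cls_mem_ideal_gen_iff[OF gens a, symmetric])
        (simp add: lpa_relation_ideal_def lpa_free_algebra_eq)
    finally show ?thesis .
  qed
  have "graded_ideal E H S \<subseteq> carrier QE.Q"
    unfolding graded_ideal_eq lpa_eq
  proof (rule ideal_gen_least)
    show "algebra_ideal QE.Q (carrier QE.Q)"
      unfolding QE.Q_ideal_iff
      by (auto simp: QE.carrier_Q QE.add_Q QE.mult_Q QE.smult_Q QE.zero_Q free_carrier_closed)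
    show "lpa_class E ` gap_generators E H S \<subseteq> carrier QE.Q"
      using gens by (auto simp: QE.carrier_Q class_eq)
  qed
  moreover have "annihilator QE.Q (breaking_module E v) \<subseteq> carrier QE.Q"
    by (auto simp: annihilator_def)
  ultimately show ?thesis
    unfolding lpa_eq using iff by (auto simp: QE.carrier_Q subset_iff image_iff)
qed

end

theorem lemma3p5:
  fixes E :: "('v, 'e) pre_digraph" and v :: 'v
  assumes "wf_digraph E"
    and "v \<in> verts E"
    and "infinite_emitter E v"
    and "v \<in> breaking_vertices E (not_above E v)"
  shows "annihilator (leavitt_path_algebra E :: ('k::field, ('v, 'e, 'k) lpa) module)
           (breaking_module E v)
       = graded_ideal E (not_above E v) (breaking_vertices E (not_above E v) - {v})"
proof -
  interpret breaking_vertex E v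
    by (intro breaking_vertex.intro breaking_vertex_axioms.intro assms)
  show ?thesis by (rule annihilator_breaking_module)
qed

end
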